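(* Let $\lambda$ be a straight or skew shape with $n$ boxes. For every $m\in\mathbb N=\{1,2,3,\dots\}$: (1) $\rho^{\lambda,m,+}\cong S^{\lambda}\uparrow_{S_n^1}^{D_n}$; (2) $\rho^{\lambda,m,-}\cong S^{\lambda}\uparrow_{S_n^0}^{D_n}$.
   Context: $D_n$ is the group of permutations $\pi$ of $\{\pm1,\dots,\pm n\}$ with $\pi(-i)=-\pi(i)$ and an even number of $i\in\{1,\dots,n\}$ with $\pi(i)<0$; its Coxeter generators are $s_0=(1,-2)(2,-1)$ and $s_i=(i,i+1)(-i,-i-1)$, $1\le i\le n-1$. $S_n^1=\langle s_1,\dots,s_{n-1}\rangle$ and $S_n^0=\langle s_0,s_2,\dots,s_{n-1}\rangle$, both identified with $S_n$ via $s_1\mapsto(1\,2)$ resp. $s_0\mapsto(1\,2)$ and $s_i\mapsto(i\,\,i{+}1)$ for $i\ge2$. $S^\lambda$ is the representation of $S_n$ on the space with basis the standard Young tableaux $Q$ of shape $\lambda$ filled with $1,\dots,n$, given by the Young orthogonal form $(i\,\,i{+}1)(Q)=\frac1{h}Q+\sqrt{1-\frac1{h^2}}\,Q^{s_i}$, where $h=c_{i+1}-c_i$ is the difference of contents of $i+1$ and $i$ in $Q$ and $Q^{s_i}$ is $Q$ with $i,i+1$ interchanged (content of box in row $r$, column $j$ is $j-r$). A D-Young tableau is a filling of a skew diagram by $\pm1,\dots,\pm n$, each number in one box and each box containing one number (a box of content $0$ may contain a pair $\pm i$), with $c_{-k}=-c_k$ where $c_k$ is the content of the box containing $k$; it is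 standard if entries increase along rows and down columns. A D-Young tableau with no box of content $0$ is regarded as determined by its positive-content part. For $\pi\in D_n$, $T^\pi$ denotes $T$ with each entry $k$ replaced by $\pi(k)$. $T[\lambda,m,+]$ (resp. $T[\lambda,m,-]$) is the set of standard D-Young tableaux whose smallest nonnegative content is $m$, whose positive-content boxes form the shape $\lambda$, with an even (resp. odd) number of negative entries among the positive-content boxes. For a standard D-Young tableau $T$ with content vector $(c_1,\dots,c_n)$ let $f(T)=(c_1+c_2,c_2-c_1,c_3-c_2,\dots,c_n-c_{n-1})$. $\rho^{\lambda,m,\pm}$ is the representation of $D_n$ on the real vector space with basis $T[\lambda,m,\pm]$ defined by $\rho_{s_i}(T)=\frac1{f_i(T)}T+\sqrt{1-\frac1{f_i(T)^2}}\,T^{s_i}$ for $i=0,\dots,n-1$ (here $f_i(T)=\pm1$ exactly when $T^{s_i}$ is not standard, in which case the second term vanishes). *)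

theory Defs
  imports Complex_Main
begin

type_synonym cell = "int \<times> int"   \<comment> \<open>(row, column)\<close>
type_synonym tab = "cell \<Rightarrow> int"   \<comment> \<open>a filling; value 0 = no entry / outside the diagram\<close>

definition content :: "cell \<Rightarrow> int" where
  "content c = snd c - fst c"

definition young_diagram :: "cell set \<Rightarrow> bool" where
  "young_diagram Y \<longleftrightarrow> finite Y \<and> (\<forall>(i,j)\<in>Y. 0 \<le> i \<and> 0 \<le> j) \<and>
     (\<forall>i j i' j'. (i,j) \<in> Y \<longrightarrow> 0 \<le> i' \<longrightarrow> i' \<le> i \<longrightarrow> 0 \<le> j' \<longrightarrow> j' \<le> j \<longrightarrow> (i',j') \<in> Y)"

definition skew_shape :: "cell set \<Rightarrow> bool" where
  "skew_shape S \<longleftrightarrow> (\<exists>Y Z. young_diagram Y \<and> young_diagram Z \<and> Z \<subseteq> Y \<and> S = Y - Z)"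

definition place :: "cell set \<Rightarrow> int \<Rightarrow> cell set" where
  "place S m = (\<lambda>(i,j). (i, j + (m - Min (content ` S)))) ` S"

definition standard_on :: "cell set \<Rightarrow> tab \<Rightarrow> bool" where
  "standard_on P T \<longleftrightarrow> (\<forall>i j i' j'. (i,j) \<in> P \<longrightarrow> (i',j') \<in> P \<longrightarrow>
      ((i = i' \<and> j < j') \<or> (j = j' \<and> i < i')) \<longrightarrow> T (i,j) < T (i',j'))"

definition signed_set :: "nat \<Rightarrow> int set" where
  "signed_set n = {k. k \<noteq> 0 \<and> \<bar>k\<bar> \<le> int n}"

definition Dn :: "nat \<Rightarrow> (int \<Rightarrow> int) set" where
  "Dn n = {\<pi>. bij_betw \<pi> (signed_set n) (signed_set n) \<and> (\<forall>k. k \<notin> signed_set n \<longrightarrow> \<pi> k = k)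
              \<and> (\<forall>k. \<pi> (- k) = - \<pi> k) \<and> even (card {i \<in> {1..int n}. \<pi> i < 0})}"

definition sgen :: "nat \<Rightarrow> int \<Rightarrow> int" where
  "sgen i k = (if i = 0 then
        (if k = 1 then -2 else if k = -2 then 1 else if k = 2 then -1 else if k = -1 then 2 else k)
      else (let a = int i in
        (if k = a then a + 1 else if k = a + 1 then a else
         if k = -a then -a - 1 else if k = -a - 1 then -a else k)))"

text \<open>The real vector space with basis B, realised as functions B -> real (zero outside B).\<close>
definition Vsp :: "tab set \<Rightarrow> (tab \<Rightarrow> real) set" where
  "Vsp B = {v. \<forall>U. U \<notin> B \<longrightarrow> v U = 0}"

text \<open>Operator on Vsp B with matrix M (M U T = coefficient of U in the image of T).\<close>
definition matop :: "tab set \<Rightarrow> (tab \<Rightarrow> tab \<Rightarrow> real) \<Rightarrow> (tab \<Rightarrow> real) \<Rightarrow> (tab \<Rightarrow> real)" where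
  "matop B M v = (\<lambda>U. if U \<in> B then (\<Sum>T\<in>B. M U T * v T) else 0)"

definition SYT :: "cell set \<Rightarrow> tab set" where
  "SYT S = {Q. (\<forall>c. c \<notin> S \<longrightarrow> Q c = 0) \<and> Q ` S = {1..int (card S)} \<and> standard_on S Q}"

definition cS :: "cell set \<Rightarrow> tab \<Rightarrow> int \<Rightarrow> int" where
  "cS S Q k = content (THE c. c \<in> S \<and> Q c = k)"

definition transp :: "int \<Rightarrow> int \<Rightarrow> int" where
  "transp i k = (if k = i then i + 1 else if k = i + 1 then i else k)"

text \<open>Action of the transposition (i i+1) on S^lambda (Young orthogonal form).\<close>
definition youngop :: "cell set \<Rightarrow> nat \<Rightarrow> (tab \<Rightarrow> real) \<Rightarrow> (tab \<Rightarrow> real)" where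
  "youngop S i = matop (SYT S) (\<lambda>U Q.
      let h = real_of_int (cS S Q (int i + 1) - cS S Q (int i)) in
      (if U = Q then 1 / h else 0) +
      (if U = transp (int i) \<circ> Q then sqrt (1 - 1 / h\<^sup>2) else 0))"

text \<open>T[lambda,m,+] (pos = True) and T[lambda,m,-] (pos = False): standard D-Young tableaux
  without content-0 boxes, represented by their positive-content part, which is the
  shape lambda placed with smallest content m.\<close>
definition Dtabs :: "cell set \<Rightarrow> nat \<Rightarrow> bool \<Rightarrow> tab set" where
  "Dtabs S m pos = (let P = place S (int m); n = card S in
     {T. (\<forall>c. c \<notin> P \<longrightarrow> T c = 0) \<and> (\<forall>c\<in>P. T c \<noteq> 0 \<and> \<bar>T c\<bar> \<le> int n)
         \<and> inj_on (\<lambda>c. \<bar>T c\<bar>) P \<and> standard_on P T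
         \<and> (even (card {c \<in> P. T c < 0}) \<longleftrightarrow> pos)})"

text \<open>Content c_k of k (k > 0) in a D-Young tableau; c_{-k} = - c_k.\<close>
definition cD :: "cell set \<Rightarrow> tab \<Rightarrow> int \<Rightarrow> int" where
  "cD P T k = (if \<exists>c\<in>P. T c = k then content (THE c. c \<in> P \<and> T c = k)
               else - content (THE c. c \<in> P \<and> T c = - k))"

definition fD :: "cell set \<Rightarrow> tab \<Rightarrow> nat \<Rightarrow> int" where
  "fD P T i = (if i = 0 then cD P T 1 + cD P T 2 else cD P T (int i + 1) - cD P T (int i))"

definition rhoop :: "cell set \<Rightarrow> nat \<Rightarrow> bool \<Rightarrow> nat \<Rightarrow> (tab \<Rightarrow> real) \<Rightarrow> (tab \<Rightarrow> real)" where
  "rhoop S m pos i = matop (Dtabs S m pos) (\<lambda>U T.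
      let f = real_of_int (fD (place S (int m)) T i) in
      (if U = T then 1 / f else 0) +
      (if U = sgen i \<circ> T then sqrt (1 - 1 / f\<^sup>2) else 0))"

text \<open>Induced representation from a subgroup H of D_n, H given by generators gens each
  paired with the operator by which it acts on the inducing representation V = Vsp B:
  Ind = {F : D_n -> V | F (h x) = sigma(h) F(x)}, the condition imposed for the generators h of H.
  D_n acts by (g F)(x) = F(x g).\<close>
definition IndV :: "nat \<Rightarrow> tab set \<Rightarrow> ((int \<Rightarrow> int) \<times> ((tab \<Rightarrow> real) \<Rightarrow> (tab \<Rightarrow> real))) set
                     \<Rightarrow> ((int \<Rightarrow> int) \<Rightarrow> tab \<Rightarrow> real) set" where
  "IndV n B gens = {F. (\<forall>x. x \<notin> Dn n \<longrightarrow> F x = (\<lambda>_. 0)) \<and> (\<forall>x\<in>Dn n. F x \<in> Vsp B)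
      \<and> (\<forall>(h,A)\<in>gens. \<forall>x\<in>Dn n. F (h \<circ> x) = A (F x))}"

definition indact :: "(int \<Rightarrow> int) \<Rightarrow> ((int \<Rightarrow> int) \<Rightarrow> tab \<Rightarrow> real) \<Rightarrow> ((int \<Rightarrow> int) \<Rightarrow> tab \<Rightarrow> real)" where
  "indact g F = (\<lambda>x. F (x \<circ> g))"

text \<open>Generators of S_n^1 = <s_1..s_{n-1}> with s_i |-> (i i+1), and of
  S_n^0 = <s_0,s_2..s_{n-1}> with s_0 |-> (1 2), s_i |-> (i i+1).\<close>
definition gens1 :: "cell set \<Rightarrow> ((int \<Rightarrow> int) \<times> ((tab \<Rightarrow> real) \<Rightarrow> (tab \<Rightarrow> real))) set" where
  "gens1 S = {(sgen i, youngop S i) | i. 1 \<le> i \<and> i < card S}"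

definition gens0 :: "cell set \<Rightarrow> ((int \<Rightarrow> int) \<times> ((tab \<Rightarrow> real) \<Rightarrow> (tab \<Rightarrow> real))) set" where
  "gens0 S = insert (sgen 0, youngop S 1) {(sgen i, youngop S i) | i. 2 \<le> i \<and> i < card S}"

text \<open>Isomorphism of representations of D_n: a linear bijection intertwining the actions
  of all Coxeter generators s_0,...,s_{n-1} (which generate D_n).\<close>
definition rep_iso :: "nat \<Rightarrow> tab set \<Rightarrow> (nat \<Rightarrow> (tab \<Rightarrow> real) \<Rightarrow> (tab \<Rightarrow> real))
     \<Rightarrow> ((int \<Rightarrow> int) \<Rightarrow> tab \<Rightarrow> real) set \<Rightarrow> bool" where
  "rep_iso n B rho W \<longleftrightarrow> (\<exists>\<Phi>. bij_betw \<Phi> (Vsp B) W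
      \<and> (\<forall>v\<in>Vsp B. \<forall>w\<in>Vsp B. \<forall>a b. \<Phi> (\<lambda>U. a * v U + b * w U) = (\<lambda>x Q. a * \<Phi> v x Q + b * \<Phi> w x Q))
      \<and> (\<forall>i<n. \<forall>v\<in>Vsp B. \<Phi> (rho i v) = indact (sgen i) (\<Phi> v)))"

end

theory Submission
  imports Defs
begin

text \<open>
  The operators \<open>\<rho>\<^sub>s\<close> satisfy the Coxeter relations of \<open>D\<^sub>n\<close>, hence extend to all of \<open>D\<^sub>n\<close>. The
  tableaux without negative entries (in case (2): those whose only negative entry is \<open>-1\<close>) span a
  copy of \<open>S\<^sup>\<lambda>\<close> that is invariant under the inducing subgroup, and so is the span of the remaining
  tableaux. Projecting onto that copy gives, by Frobenius reciprocity, an intertwiner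
  \<open>\<Phi>(v)(x) = proj (\<rho>(x) v)\<close> into the induced representation. It is injective because every
  tableau is joined to one in the copy by steps \<open>T \<mapsto> T\<^sup>s\<close> whose off-diagonal coefficient is nonzero:
  exchanging entries of opposite sign has \<open>|f\<^sub>i| \<ge> 2\<close>. It is surjective by counting dimensions:
  elements of the induced representation are determined by their values on coset representatives,
  and pairs of a representative and a standard tableau of shape \<open>\<lambda>\<close> inject into the basis.
  Both cases are treated at once: conjugation by the sign change of \<open>1\<close> carries \<open>S\<^sub>n\<^sup>1\<close> to \<open>S\<^sub>n\<^sup>0\<close>.
\<close>

section \<open>The group \<open>D\<^sub>n\<close> and its Coxeter presentation\<close>

text \<open>\<open>simple_val c i\<close> pairs \<open>c\<close> with the \<open>i\<close>-th simple
  root. On a content vector it is \<open>f_i\<close>; on a group element its sign decides whether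
  \<open>s_i\<close> is a right descent. One set of reflection formulas thus serves both the word
  problem in the group and the evaluation of the operators. Two obstacles shape the proof of the
  relations. The formulas divide by \<open>f_i\<close> and, in the braid relation, by
  \<open>f_i + f_j\<close>. Both are nonzero because equal contents force two further entries
  strictly in between, for which the values involved leave no room. Moreover \<open>T^s\<close> may
  fail to be standard; then \<open>|f_i| = 1\<close>, so the square root vanishes, and the
  coordinate formulas need no case distinction. The bound \<open>|f_i| \<ge> 2\<close> comes from
  \<open>m \<ge> 1\<close>: every cell has content at least 1, so for entries of opposite sign the
  two contents add up instead of cancelling.\<close>

definition simple_val :: "(int \<Rightarrow> int) \<Rightarrow> nat \<Rightarrow> int" where
  "simple_val c i = (if i = 0 then c 1 + c 2 else c (int i + 1) - c (int i))"

definition odd_fun :: "(int \<Rightarrow> int) \<Rightarrow> bool" where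
  "odd_fun c \<longleftrightarrow> (\<forall>k. c (- k) = - c k)"

text \<open>Edges of the Dynkin diagram of type D: at the fork, node 0 is joined to 2 and not to
  1.\<close>

definition adjacent :: "nat \<Rightarrow> nat \<Rightarrow> bool" where
  "adjacent i j \<longleftrightarrow> (0 < i \<and> j = Suc i) \<or> (0 < j \<and> i = Suc j) \<or> (i = 0 \<and> j = 2) \<or> (i = 2 \<and> j = 0)"

lemma sgen_minus: "sgen i (- k) = - sgen i k"
  by (auto simp: sgen_def Let_def)

lemma sgen_sgen [simp]: "sgen i (sgen i k) = k"
  by (auto simp: sgen_def Let_def)

lemma sgen_o_sgen: "sgen i \<circ> sgen i = id"
  by (auto simp: fun_eq_iff)

lemma sgen_eq_iff: "sgen i a = b \<longleftrightarrow> a = sgen i b"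
  by (metis sgen_sgen)

text \<open>\<open>max i 1\<close> is the smaller of the two absolute values moved by
  \<open>s_i\<close>; it gives \<open>s_0\<close> and \<open>s_1\<close> the common support 1,
  2.\<close>

lemma sgen_fixes:
  assumes "\<bar>k\<bar> \<noteq> int (max i 1)" "\<bar>k\<bar> \<noteq> int (max i 1) + 1"
  shows "sgen i k = k"
  using assms by (cases "i = 0") (auto simp: sgen_def Let_def)

lemma abs_sgen:
  assumes "\<bar>k\<bar> = int (max i 1) \<or> \<bar>k\<bar> = int (max i 1) + 1"
  shows "\<bar>sgen i k\<bar> = int (max i 1) \<or> \<bar>sgen i k\<bar> = int (max i 1) + 1"
  using assms by (cases "i = 0") (auto simp: sgen_def Let_def)

text \<open>Disjoint supports commute. The only non-adjacent pair sharing a support is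
  \<open>s_0\<close>, \<open>s_1\<close>, which is checked on values.\<close>

lemma sgen_commute:
  assumes "i \<noteq> j" "\<not> adjacent i j"
  shows "sgen i (sgen j k) = sgen j (sgen i k)"
proof (cases "max i 1 = max j 1")
  case True
  then have "(i = 0 \<and> j = 1) \<or> (i = 1 \<and> j = 0)" using assms by (auto simp: max_def split: if_splits)
  moreover have "sgen 0 (sgen 1 k) = sgen 1 (sgen 0 k)"
    by (cases "k \<in> {1, 2, -1, -2}") (auto simp: sgen_def)
  ultimately show ?thesis by auto
next
  case False
  have "max i 1 \<noteq> max j 1 + 1" "max j 1 \<noteq> max i 1 + 1"
    using assms by (auto simp: adjacent_def max_def split: if_splits)
  with False have disj: "a \<noteq> b" if "a \<in> {int (max i 1), int (max i 1) + 1}"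
    "b \<in> {int (max j 1), int (max j 1) + 1}" for a b
    using that by (auto simp del: of_nat_max)
  consider "\<bar>k\<bar> \<in> {int (max i 1), int (max i 1) + 1}" | "\<bar>k\<bar> \<in> {int (max j 1), int (max j 1) + 1}"
    | "\<bar>k\<bar> \<notin> {int (max i 1), int (max i 1) + 1}" "\<bar>k\<bar> \<notin> {int (max j 1), int (max j 1) + 1}" by blast
  then show ?thesis
  proof cases
    case 1
    then have "\<bar>sgen i k\<bar> \<in> {int (max i 1), int (max i 1) + 1}" using abs_sgen[of k i] by blast
    with 1 show ?thesis
      using disj sgen_fixes[of k j] sgen_fixes[of "sgen i k" j] by (metis insertCI)
  next
    case 2
    then have "\<bar>sgen j k\<bar> \<in> {int (max j 1), int (max j 1) + 1}" using abs_sgen[of k j] by blast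
    with 2 show ?thesis
      using disj sgen_fixes[of k i] sgen_fixes[of "sgen j k" i] by (metis insertCI)
  next
    case 3
    then show ?thesis using sgen_fixes[of k i] sgen_fixes[of k j] by (metis insertCI)
  qed
qed

lemma sgen_braid_aux:
  assumes "(0 < i \<and> j = Suc i) \<or> (i = 0 \<and> j = 2)"
  shows "sgen i (sgen j (sgen i k)) = sgen j (sgen i (sgen j k))"
  using assms
proof
  assume ij: "0 < i \<and> j = Suc i"
  have base: "sgen i (sgen j (sgen i k)) = sgen j (sgen i (sgen j k))" if "0 \<le> k" for k
  proof -
    have si: "sgen i l = (if l = int i then int i + 1 else if l = int i + 1 then int i else l)"
      "sgen j l = (if l = int i + 1 then int i + 2 else if l = int i + 2 then int i + 1 else l)"
      if "0 \<le> l" for l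
      using ij that by (simp_all add: sgen_def)
    consider "k = int i" | "k = int i + 1" | "k = int i + 2" | "k \<notin> {int i, int i + 1, int i + 2}" by blast
    then show ?thesis using that by cases (simp_all add: si)
  qed
  show ?thesis
    using base[of k] base[of "- k"] by (cases "0 \<le> k") (auto simp: sgen_minus)
next
  assume "i = 0 \<and> j = 2"
  then show ?thesis
    by (cases "k \<in> {1, 2, 3, -1, -2, -3}") (auto simp: sgen_def)
qed

lemma sgen_braid:
  assumes "adjacent i j"
  shows "sgen i (sgen j (sgen i k)) = sgen j (sgen i (sgen j k))"
  using assms sgen_braid_aux[of i j k] sgen_braid_aux[of j i k] by (auto simp: adjacent_def)

text \<open>This and the next two lemmas are the reflection formulas of a simply laced root system:
  \<open>s_i\<close> negates its own root, sends the root of an adjacent node \<open>j\<close> to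
  the sum of the two roots, and fixes the remaining simple roots.\<close>

lemma simple_val_self:
  assumes "odd_fun c"
  shows "simple_val (c \<circ> sgen i) i = - simple_val c i"
  using assms[unfolded odd_fun_def, rule_format, of 1] assms[unfolded odd_fun_def, rule_format, of 2]
  by (auto simp: simple_val_def sgen_def)

lemma simple_val_adjacent:
  assumes "odd_fun c" "adjacent i j"
  shows "simple_val (c \<circ> sgen i) j = simple_val c i + simple_val c j"
  using assms(2) assms(1)[unfolded odd_fun_def, rule_format, of 1] assms(1)[unfolded odd_fun_def, rule_format, of 2]
  by (auto simp: simple_val_def sgen_def adjacent_def add.commute)

lemma simple_val_commute:
  assumes "odd_fun c" "i \<noteq> j" "\<not> adjacent i j"
  shows "simple_val (c \<circ> sgen i) j = simple_val c j"
proof -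
  consider "i = 0" "j = 1" | "i = 1" "j = 0" | "j = 0" "3 \<le> i" | "0 < j" "j + 2 \<le> max i 1 \<or> max i 1 + 2 \<le> j"
    using assms(2,3) unfolding adjacent_def max_def by (atomize_elim, presburger)
  then show ?thesis
  proof cases
    case 1
    then show ?thesis using assms(1)[unfolded odd_fun_def, rule_format, of 1] assms(1)[unfolded odd_fun_def, rule_format, of 2] by (simp add: simple_val_def sgen_def)
  next
    case 2
    then show ?thesis by (simp add: simple_val_def sgen_def)
  next
    case 3
    then show ?thesis using sgen_fixes[of 1 i] sgen_fixes[of 2 i] by (simp add: simple_val_def)
  next
    case 4
    then have "sgen i (int j) = int j" "sgen i (int j + 1) = int j + 1"
      using sgen_fixes[of "int j" i] sgen_fixes[of "int j + 1" i] by (auto simp: max_def split: if_splits)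
    then show ?thesis using 4 by (simp add: simple_val_def)
  qed
qed

section \<open>Signed permutations and the sign homomorphism\<close>

definition signed_perms :: "nat \<Rightarrow> (int \<Rightarrow> int) set" where
  "signed_perms n = {\<pi>. bij_betw \<pi> (signed_set n) (signed_set n) \<and>
     (\<forall>k. k \<notin> signed_set n \<longrightarrow> \<pi> k = k) \<and> (\<forall>k. \<pi> (- k) = - \<pi> k)}"

text \<open>Unlike a count of negative values, the product of signs is multiplicative; its kernel on
  the signed permutations is \<open>D_n\<close>. The larger group is present because the sign change
  of 1 in case (2) lies outside \<open>D_n\<close>.\<close>

definition sign_prod :: "nat \<Rightarrow> (int \<Rightarrow> int) \<Rightarrow> int" where
  "sign_prod n \<pi> = (\<Prod>k\<in>{1..int n}. sgn (\<pi> k))"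

lemma prod_sgn_eq_power:
  fixes f :: "'a \<Rightarrow> int"
  assumes "finite A" "\<forall>a\<in>A. f a \<noteq> 0"
  shows "(\<Prod>a\<in>A. sgn (f a)) = (-1) ^ card {a\<in>A. f a < 0}"
  using assms
proof (induction A rule: finite_induct)
  case (insert x A)
  have "{a \<in> insert x A. f a < 0} = (if f x < 0 then insert x {a\<in>A. f a < 0} else {a\<in>A. f a < 0})"
    by auto
  with insert show ?case by (auto simp: sgn_if)
qed simp

lemma even_card_neg_iff_prod_sgn:
  fixes f :: "'a \<Rightarrow> int"
  assumes "finite A" "\<forall>a\<in>A. f a \<noteq> 0"
  shows "even (card {a\<in>A. f a < 0}) \<longleftrightarrow> (\<Prod>a\<in>A. sgn (f a)) = 1"
  unfolding prod_sgn_eq_power[OF assms] by (simp add: minus_one_power_iff)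

lemma signed_set_iff: "k \<in> signed_set n \<longleftrightarrow> k \<noteq> 0 \<and> \<bar>k\<bar> \<le> int n"
  by (simp add: signed_set_def)

lemma signed_perms_odd: "\<pi> \<in> signed_perms n \<Longrightarrow> \<pi> (- k) = - \<pi> k"
  by (simp add: signed_perms_def)

lemma odd_fun_signed_perms: "\<pi> \<in> signed_perms n \<Longrightarrow> odd_fun \<pi>"
  by (simp add: signed_perms_def odd_fun_def)

lemma signed_perms_zero: "\<pi> \<in> signed_perms n \<Longrightarrow> \<pi> 0 = 0"
  by (simp add: signed_perms_def signed_set_def)

lemma signed_perms_mem_iff:
  assumes "\<pi> \<in> signed_perms n"
  shows "\<pi> k \<in> signed_set n \<longleftrightarrow> k \<in> signed_set n"
  using assms unfolding signed_perms_def by (smt (verit) bij_betwE mem_Collect_eq)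

lemma bij_signed_perms:
  assumes "\<pi> \<in> signed_perms n"
  shows "bij \<pi>"
proof -
  have "bij_betw \<pi> (signed_set n \<union> - signed_set n) (signed_set n \<union> - signed_set n)"
  proof (rule bij_betw_combine)
    show "bij_betw \<pi> (- signed_set n) (- signed_set n)"
      using assms bij_betw_cong[of "- signed_set n" \<pi> id] by (simp add: signed_perms_def)
  qed (use assms in \<open>auto simp: signed_perms_def\<close>)
  then show ?thesis by simp
qed

lemma signed_perms_nonzero:
  assumes "\<pi> \<in> signed_perms n" "k \<noteq> 0"
  shows "\<pi> k \<noteq> 0"
  using assms bij_signed_perms[OF assms(1)] signed_perms_zero[OF assms(1)]
  by (metis bij_is_inj injD)

lemma signed_perms_abs_le_iff:
  assumes "\<pi> \<in> signed_perms n"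
  shows "\<bar>\<pi> k\<bar> \<le> int n \<longleftrightarrow> \<bar>k\<bar> \<le> int n"
proof (cases "k = 0")
  case True
  then show ?thesis using signed_perms_zero[OF assms] by simp
next
  case False
  then show ?thesis
    using signed_perms_mem_iff[OF assms, of k] signed_perms_nonzero[OF assms, of k] by (simp add: signed_set_iff)
qed

lemma signed_perms_abs_eq_iff:
  assumes "\<pi> \<in> signed_perms n"
  shows "\<bar>\<pi> a\<bar> = \<bar>\<pi> b\<bar> \<longleftrightarrow> \<bar>a\<bar> = \<bar>b\<bar>"
proof -
  have "inj \<pi>" using bij_signed_perms[OF assms] by (simp add: bij_is_inj)
  then show ?thesis
    using signed_perms_odd[OF assms] by (metis abs_eq_iff injD)
qed

lemma signed_perms_abs_bij:
  assumes "\<pi> \<in> signed_perms n"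
  shows "bij_betw (\<lambda>k. \<bar>\<pi> k\<bar>) {1..int n} {1..int n}"
proof -
  have inj: "inj_on (\<lambda>k. \<bar>\<pi> k\<bar>) {1..int n}"
    using signed_perms_abs_eq_iff[OF assms] by (auto simp: inj_on_def)
  have sub: "(\<lambda>k. \<bar>\<pi> k\<bar>) ` {1..int n} \<subseteq> {1..int n}"
    using signed_perms_abs_le_iff[OF assms] signed_perms_nonzero[OF assms]
    by (auto simp: image_subset_iff) (smt (verit))
  show ?thesis
    using inj sub by (simp add: bij_betw_def endo_inj_surj)
qed

lemma signed_perms_sgn:
  assumes "\<pi> \<in> signed_perms n"
  shows "sgn (\<pi> k) = sgn k * sgn (\<pi> \<bar>k\<bar>)"
  using signed_perms_odd[OF assms, of "-k"] signed_perms_zero[OF assms]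
  by (cases "k < 0"; cases "k = 0") (auto simp: sgn_minus)

text \<open>Each sign splits as \<open>sgn (t a) * sgn (\<pi> |t a|)\<close>, and
  \<open>|t a|\<close> runs once through \<open>1..n\<close>, so the second factors multiply to a
  constant. With \<open>t\<close> a signed permutation this gives the homomorphism property; with
  \<open>t\<close> a tableau it tracks the parity of negative entries.\<close>

lemma prod_sgn_signed_perm:
  assumes "\<pi> \<in> signed_perms n" "bij_betw (\<lambda>a. \<bar>t a\<bar>) A {1..int n}"
  shows "(\<Prod>a\<in>A. sgn (\<pi> (t a))) = (\<Prod>a\<in>A. sgn (t a)) * sign_prod n \<pi>"
proof -
  have "(\<Prod>a\<in>A. sgn (\<pi> (t a))) = (\<Prod>a\<in>A. sgn (t a) * sgn (\<pi> \<bar>t a\<bar>))"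
    by (rule prod.cong) (auto simp: signed_perms_sgn[OF assms(1), symmetric])
  also have "\<dots> = (\<Prod>a\<in>A. sgn (t a)) * (\<Prod>a\<in>A. sgn (\<pi> \<bar>t a\<bar>))"
    by (simp add: prod.distrib)
  also have "(\<Prod>a\<in>A. sgn (\<pi> \<bar>t a\<bar>)) = sign_prod n \<pi>"
    unfolding sign_prod_def by (rule prod.reindex_bij_betw[OF assms(2)])
  finally show ?thesis .
qed

lemma signed_perms_comp:
  assumes "\<pi> \<in> signed_perms n" "\<sigma> \<in> signed_perms n"
  shows "\<pi> \<circ> \<sigma> \<in> signed_perms n"
  using assms unfolding signed_perms_def by (auto intro: bij_betw_trans)

lemma signed_perms_id: "id \<in> signed_perms n"
  by (simp add: signed_perms_def)

lemma signed_perms_inv: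
  assumes "\<pi> \<in> signed_perms n"
  shows "inv \<pi> \<in> signed_perms n"
proof -
  have b: "bij \<pi>" using bij_signed_perms[OF assms] .
  have i: "inv \<pi> k = l \<longleftrightarrow> k = \<pi> l" for k l
    using b by (metis bij_inv_eq_iff)
  have "bij_betw (inv \<pi>) (signed_set n) (signed_set n)"
    unfolding bij_betw_def
  proof
    show "inj_on (inv \<pi>) (signed_set n)"
      using b by (meson bij_imp_bij_inv bij_is_inj inj_on_subset subset_UNIV)
    have "\<pi> ` signed_set n = signed_set n"
      using assms by (simp add: signed_perms_def bij_betw_def)
    then show "inv \<pi> ` signed_set n = signed_set n"
      using b by (metis bij_is_inj image_inv_f_f)
  qed
  moreover have "inv \<pi> k = k" if "k \<notin> signed_set n" for k
    using that assms by (simp add: i signed_perms_def)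
  moreover have "inv \<pi> (- k) = - inv \<pi> k" for k
    using signed_perms_odd[OF assms] b by (simp add: i bij_is_surj surj_f_inv_f)
  ultimately show ?thesis by (simp add: signed_perms_def)
qed

lemma sign_prod_comp:
  assumes "\<pi> \<in> signed_perms n" "\<sigma> \<in> signed_perms n"
  shows "sign_prod n (\<pi> \<circ> \<sigma>) = sign_prod n \<sigma> * sign_prod n \<pi>"
  using prod_sgn_signed_perm[OF assms(1) signed_perms_abs_bij[OF assms(2)]]
  by (simp add: sign_prod_def)

lemma sign_prod_id: "sign_prod n id = 1"
  by (simp add: sign_prod_def)

lemma Dn_iff: "\<pi> \<in> Dn n \<longleftrightarrow> \<pi> \<in> signed_perms n \<and> sign_prod n \<pi> = 1"
proof -
  have "even (card {i \<in> {1..int n}. \<pi> i < 0}) \<longleftrightarrow> sign_prod n \<pi> = 1" if "\<pi> \<in> signed_perms n"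
    unfolding sign_prod_def
    by (rule even_card_neg_iff_prod_sgn) (use signed_perms_nonzero[OF that] in auto)
  then show ?thesis by (auto simp: Dn_def signed_perms_def)
qed

lemma Dn_signed: "\<pi> \<in> Dn n \<Longrightarrow> \<pi> \<in> signed_perms n"
  by (simp add: Dn_iff)

lemma Dn_id: "id \<in> Dn n"
  by (simp add: Dn_iff signed_perms_id sign_prod_id)

lemma Dn_comp: "\<pi> \<in> Dn n \<Longrightarrow> \<sigma> \<in> Dn n \<Longrightarrow> \<pi> \<circ> \<sigma> \<in> Dn n"
  by (simp add: Dn_iff signed_perms_comp sign_prod_comp)

lemma Dn_inv:
  assumes "\<pi> \<in> Dn n"
  shows "inv \<pi> \<in> Dn n"
proof -
  have s: "\<pi> \<in> signed_perms n" "inv \<pi> \<in> signed_perms n"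
    using assms by (auto simp: Dn_iff signed_perms_inv)
  have "\<pi> \<circ> inv \<pi> = id"
    using bij_signed_perms[OF s(1)] bij_is_surj surj_iff by blast
  with sign_prod_comp[OF s] assms show ?thesis
    by (simp add: Dn_iff s sign_prod_id)
qed

lemma involution_signed_perm:
  assumes "\<And>k. \<pi> (\<pi> k) = k" "\<And>k. k \<notin> signed_set n \<Longrightarrow> \<pi> k = k" "\<And>k. \<pi> (- k) = - \<pi> k"
  shows "\<pi> \<in> signed_perms n"
proof -
  have "\<pi> k \<in> signed_set n" if "k \<in> signed_set n" for k
    using that assms(1,2) by metis
  then have "bij_betw \<pi> (signed_set n) (signed_set n)"
    by (intro bij_betw_byWitness[where f' = \<pi>]) (auto simp: assms(1))
  with assms show ?thesis by (simp add: signed_perms_def)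
qed

lemma sgen_Dn:
  assumes "i < n" "2 \<le> n"
  shows "sgen i \<in> Dn n"
proof -
  have "sgen i k = k" if "k \<notin> signed_set n" for k
    using that assms by (auto simp: sgen_def signed_set_iff Let_def)
  then have s: "sgen i \<in> signed_perms n"
    by (intro involution_signed_perm) (auto simp: sgen_minus)
  have "{k \<in> {1..int n}. sgen i k < 0} = (if i = 0 then {1, 2} else {})"
    using assms by (auto simp: sgen_def Let_def split: if_splits)
  then show ?thesis using s by (simp add: Dn_def signed_perms_def)
qed

lemma Dn_comp_sgen_iff:
  assumes "i < n" "2 \<le> n"
  shows "x \<circ> sgen i \<in> Dn n \<longleftrightarrow> x \<in> Dn n"
  using Dn_comp[OF _ sgen_Dn[OF assms]] by (metis comp_assoc comp_id sgen_o_sgen)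

text \<open>At the first disagreement, the smaller value must be attained by the other function at
  an earlier index, where both agree; this contradicts strictness.\<close>

lemma strict_mono_same_image_eq:
  fixes f g :: "int \<Rightarrow> int"
  assumes "strict_mono_on {1..n} f" "strict_mono_on {1..n} g" "f ` {1..n} = g ` {1..n}"
  shows "k \<in> {1..n} \<Longrightarrow> f k = g k"
proof (induction "nat k" arbitrary: k rule: less_induct)
  case less
  have key: "\<not> a k < b k"
    if ab: "strict_mono_on {1..n} a" "strict_mono_on {1..n} b" "a ` {1..n} = b ` {1..n}"
      and IH: "\<And>l. l \<in> {1..n} \<Longrightarrow> l < k \<Longrightarrow> a l = b l" for a b :: "int \<Rightarrow> int"
  proof
    assume lt: "a k < b k"
    obtain l where l: "l \<in> {1..n}" "a k = b l"
      using less.prems ab(3) by (metis imageE imageI)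
    have "l < k"
      using l lt less.prems strict_mono_onD[OF ab(2), of k l] by (cases l k rule: linorder_cases) auto
    then have "a l < a k" "a l = b l"
      using IH l strict_mono_onD[OF ab(1)] less.prems by blast+
    with l show False by simp
  qed
  have "f l = g l" if "l \<in> {1..n}" "l < k" for l
    using less.hyps[of l] that less.prems by auto
  then show ?case
    using key[of f g] key[of g f] assms by (metis linorder_neqE)
qed

section \<open>Descents and the induction along them\<close>

lemma strict_mono_on_stepI:
  fixes f :: "int \<Rightarrow> int"
  assumes "\<And>i. 1 \<le> i \<Longrightarrow> i < n \<Longrightarrow> f i < f (i + 1)"
  shows "strict_mono_on {1..n} f"
proof (rule strict_mono_onI)
  fix r s :: int assume "r \<in> {1..n}" "s \<in> {1..n}" "r < s"
  then have r: "1 \<le> r" and "r + 1 \<le> s" "s \<le> n" by auto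
  from this(2,3) show "f r < f s"
  proof (induction s rule: int_ge_induct)
    case base
    then show ?case using assms r by auto
  next
    case (step s)
    then show ?case using assms[of s] r by auto
  qed
qed

text \<open>Increasing values with \<open>x 1 + x 2 > 0\<close> leave only \<open>x 1\<close> free
  to be negative, which the even number of signs forbids; an increasing arrangement of
  \<open>1..n\<close> is the identity. Used in the contrapositive: every other element has a
  descent.\<close>

lemma Dn_dominant_imp_id:
  assumes x: "x \<in> Dn n" and n: "2 \<le> n" and dom: "\<And>i. i < n \<Longrightarrow> 0 < simple_val x i"
  shows "x = id"
proof -
  have s: "x \<in> signed_perms n" using x by (rule Dn_signed)
  have mono: "strict_mono_on {1..int n} x"
  proof (rule strict_mono_on_stepI)
    fix i :: int assume "1 \<le> i" "i < int n"
    then show "x i < x (i + 1)" using dom[of "nat i"] by (simp add: simple_val_def)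
  qed
  have x12: "0 < x 1 + x 2" using dom[of 0] n by (simp add: simple_val_def)
  have xpos: "0 < x k" if "2 \<le> k" "k \<le> int n" for k
    using x12 strict_mono_onD[OF mono, of 1 2] strict_mono_onD[OF mono, of 2 k] that n
    by (cases "k = 2") auto
  have "0 < x 1"
  proof (rule ccontr)
    assume "\<not> 0 < x 1"
    then have "{i \<in> {1..int n}. x i < 0} = {1}"
      using signed_perms_nonzero[OF s, of 1] xpos n
      by (auto; smt (verit))
    with x show False by (simp add: Dn_def)
  qed
  with xpos have pos: "0 < x k" if "k \<in> {1..int n}" for k
    using that by (cases "k = 1") auto
  have "(\<lambda>k. \<bar>x k\<bar>) ` {1..int n} = {1..int n}"
    using signed_perms_abs_bij[OF s] by (simp add: bij_betw_def)
  moreover have "(\<lambda>k. \<bar>x k\<bar>) ` {1..int n} = x ` {1..int n}"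
    by (rule image_cong) (use pos in force)+
  ultimately have "x ` {1..int n} = id ` {1..int n}" by simp
  then have eq: "x k = k" if "k \<in> {1..int n}" for k
    using strict_mono_same_image_eq[OF mono, of id k] that by (simp add: strict_mono_on_def)
  have "x k = k" for k
  proof (cases "k \<in> signed_set n")
    case True
    then show ?thesis
      using eq[of k] eq[of "- k"] signed_perms_odd[OF s, of k] by (cases "k < 0") (auto simp: signed_set_iff)
  next
    case False
    then show ?thesis using s by (simp add: signed_perms_def)
  qed
  then show ?thesis by auto
qed

text \<open>A substitute for the Coxeter length: it strictly increases when a right descent is removed.\<close>

definition pairing :: "nat \<Rightarrow> (int \<Rightarrow> int) \<Rightarrow> int" where
  "pairing n x = (\<Sum>k\<in>{1..int n}. k * x k)"

lemma sum_two_terms: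
  fixes f :: "int \<Rightarrow> int"
  assumes "a \<in> A" "b \<in> A" "a \<noteq> b" "finite A"
  shows "sum f A = f a + f b + sum f (A - {a, b})"
proof -
  have "sum f A = sum f {a, b} + sum f (A - {a, b})"
    using assms by (subst add.commute, intro sum.subset_diff) auto
  then show ?thesis using assms by simp
qed

text \<open>The factors 3 and 1 are the pairings of the vector \<open>(1,...,n)\<close> with the
  roots \<open>e_1 + e_2\<close> and \<open>e_{i+1} - e_i\<close>. Both are positive, so removing a
  descent raises \<open>pairing\<close>.\<close>

lemma pairing_sgen:
  assumes "i < n" "2 \<le> n" "odd_fun x"
  shows "pairing n (x \<circ> sgen i) = pairing n x - (if i = 0 then 3 else 1) * simple_val x i"
proof -
  define a where "a = (if i = 0 then 1 else int i)"
  have ab: "a \<in> {1..int n}" "a + 1 \<in> {1..int n}" "a \<noteq> a + 1" "finite {1..int n}"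
    using assms by (auto simp: a_def)
  have rest: "(\<Sum>k\<in>{1..int n} - {a, a + 1}. k * (x \<circ> sgen i) k) = (\<Sum>k\<in>{1..int n} - {a, a + 1}. k * x k)"
    by (rule sum.cong) (auto simp: a_def sgen_def split: if_splits)
  show ?thesis
    unfolding pairing_def sum_two_terms[OF ab] rest
    using assms(3)[unfolded odd_fun_def, rule_format, of 1] assms(3)[unfolded odd_fun_def, rule_format, of 2]
    by (auto simp: a_def sgen_def simple_val_def algebra_simps)
qed

lemma pairing_le:
  assumes "x \<in> signed_perms n"
  shows "pairing n x \<le> int n * int n * int n"
proof -
  have "k * x k \<le> int n * int n" if "k \<in> {1..int n}" for k
  proof -
    have "\<bar>x k\<bar> \<le> int n" using that signed_perms_abs_le_iff[OF assms] by auto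
    then have "k * x k \<le> k * int n" using that by (intro mult_left_mono) auto
    also have "\<dots> \<le> int n * int n" using that by (intro mult_right_mono) auto
    finally show ?thesis .
  qed
  then have "pairing n x \<le> of_nat (card {1..int n}) * (int n * int n)"
    unfolding pairing_def by (rule sum_bounded_above)
  then show ?thesis by (simp add: mult.assoc)
qed

lemma simple_val_nonzero:
  assumes "x \<in> signed_perms n" "2 \<le> n"
  shows "simple_val x i \<noteq> 0"
proof -
  have "\<bar>x a\<bar> \<noteq> \<bar>x b\<bar>" if "\<bar>a\<bar> \<noteq> \<bar>b\<bar>" for a b
    using that signed_perms_abs_eq_iff[OF assms(1)] by simp
  from this[of 1 2] this[of "int i" "int i + 1"] show ?thesis
    by (auto simp: simple_val_def)
qed

text \<open>The bound \<open>n^3\<close> on \<open>pairing\<close> makes this terminate. The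
  hypothesis covers every element of larger pairing, so several descents can be stripped within one
  step.\<close>

lemma Dn_descent_induct [consumes 2, case_names descent]:
  assumes "x \<in> Dn n" "2 \<le> n"
    and "\<And>x. x \<in> Dn n \<Longrightarrow> (\<And>y. y \<in> Dn n \<Longrightarrow> pairing n x < pairing n y \<Longrightarrow> P y) \<Longrightarrow> P x"
  shows "P x"
  using assms(1)
proof (induction "nat (int n * int n * int n - pairing n x)" arbitrary: x rule: less_induct)
  case less
  show ?case
  proof (rule assms(3)[OF less.prems])
    fix y assume "y \<in> Dn n" "pairing n x < pairing n y"
    then show "P y"
      using less.hyps[of y] pairing_le[OF Dn_signed, of y n] by auto
  qed
qed

lemma Dn_generated_induct [consumes 2, case_names id step]:
  assumes "x \<in> Dn n" "2 \<le> n" "P id"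
    and "\<And>x i. x \<in> Dn n \<Longrightarrow> i < n \<Longrightarrow> P x \<Longrightarrow> P (x \<circ> sgen i)"
  shows "P x"
  using assms(1,2)
proof (induction rule: Dn_descent_induct)
  case (descent x)
  show "P x"
  proof (cases "\<forall>i<n. 0 < simple_val x i")
    case True
    then show ?thesis using Dn_dominant_imp_id[OF descent(1) assms(2)] assms(3) by blast
  next
    case False
    then obtain i where i: "i < n" "simple_val x i < 0"
      using simple_val_nonzero[OF Dn_signed[OF descent(1)] assms(2)] by (meson linorder_neqE)
    define y where "y = x \<circ> sgen i"
    have y: "y \<in> Dn n" using i descent assms(2) by (simp add: y_def Dn_comp_sgen_iff)
    have "pairing n x < pairing n y"
      unfolding y_def using i pairing_sgen[OF i(1) assms(2) odd_fun_signed_perms[OF Dn_signed[OF descent(1)]]] by auto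
    then have "P (y \<circ> sgen i)" using assms(4)[OF y i(1)] descent(2) y by blast
    then show ?thesis by (simp add: y_def comp_assoc sgen_o_sgen)
  qed
qed

section \<open>Extending operators from the generators to the group\<close>

text \<open>The idempotent \<open>pr\<close> plays the role of the identity, because operators given by matrices
  on a finite basis annihilate whatever lies outside that basis.\<close>

locale Dn_operators =
  fixes n :: nat and R :: "nat \<Rightarrow> 'v \<Rightarrow> 'v" and pr :: "'v \<Rightarrow> 'v"
  assumes n2: "2 \<le> n"
    and square: "i < n \<Longrightarrow> R i \<circ> R i = pr"
    and R_pr: "i < n \<Longrightarrow> R i \<circ> pr = R i"
    and pr_R: "i < n \<Longrightarrow> pr \<circ> R i = R i"
    and commute: "\<lbrakk>i < n; j < n; i \<noteq> j; \<not> adjacent i j\<rbrakk> \<Longrightarrow> R i \<circ> R j = R j \<circ> R i"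
    and braid: "\<lbrakk>i < n; j < n; adjacent i j\<rbrakk> \<Longrightarrow> R i \<circ> R j \<circ> R i = R j \<circ> R i \<circ> R j"
begin

text \<open>Only ascents are allowed as steps, so the operators related to \<open>x\<close> are the
  products along its reduced words. Their uniqueness is then a form of Matsumoto's theorem, with no
  cancellation of \<open>s_i s_i\<close> to consider.\<close>

inductive eval_to :: "(int \<Rightarrow> int) \<Rightarrow> ('v \<Rightarrow> 'v) \<Rightarrow> bool" where
  eval_id: "eval_to id pr"
| eval_step: "eval_to x A \<Longrightarrow> i < n \<Longrightarrow> 0 < simple_val x i \<Longrightarrow> eval_to (x \<circ> sgen i) (A \<circ> R i)"

lemma eval_to_Dn: "eval_to x A \<Longrightarrow> x \<in> Dn n"
proof (induction rule: eval_to.induct)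
  case eval_id
  show "id \<in> Dn n" by (rule Dn_id)
next
  case (eval_step x A i)
  then show "x \<circ> sgen i \<in> Dn n" by (simp add: Dn_comp_sgen_iff n2)
qed

lemma descent_dec:
  assumes "x \<in> Dn n" "i < n" "simple_val x i < 0"
  shows "pairing n x < pairing n (x \<circ> sgen i)"
  using pairing_sgen[OF assms(2) n2 odd_fun_signed_perms[OF Dn_signed[OF assms(1)]]] assms by auto

lemma descent_flip:
  assumes "x \<in> Dn n"
  shows "simple_val (x \<circ> sgen i) i = - simple_val x i"
  using simple_val_self odd_fun_signed_perms[OF Dn_signed[OF assms]] by blast

lemma eval_descent:
  assumes "x \<in> Dn n" "i < n" "simple_val x i < 0" "eval_to (x \<circ> sgen i) A"
  shows "eval_to x (A \<circ> R i)"
  using eval_step[OF assms(4,2)] descent_flip[OF assms(1)] assms(3)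
  by (simp add: comp_assoc sgen_o_sgen)

lemma eval_to_exists:
  assumes "x \<in> Dn n"
  shows "\<exists>A. eval_to x A"
  using assms n2
proof (induction rule: Dn_descent_induct)
  case (descent x)
  have IH: "\<exists>A. eval_to y A" if "y \<in> Dn n" "pairing n x < pairing n y" for y
    using that by (rule descent(2))
  show "\<exists>A. eval_to x A"
  proof (cases "\<forall>i<n. 0 < simple_val x i")
    case True
    then show ?thesis using Dn_dominant_imp_id[OF descent(1) n2] eval_id by blast
  next
    case False
    then obtain i where i: "i < n" "simple_val x i < 0"
      using simple_val_nonzero[OF Dn_signed[OF descent(1)] n2] by (meson linorder_neqE)
    then obtain A where "eval_to (x \<circ> sgen i) A"
      using IH[of "x \<circ> sgen i"] descent_dec[OF descent(1)] descent(1) n2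
      by (auto simp: Dn_comp_sgen_iff)
    then show ?thesis using eval_descent[OF descent(1) i] by blast
  qed
qed

lemma eval_to_cases:
  assumes "eval_to x A"
  shows "(x = id \<and> A = pr) \<or>
    (\<exists>i A'. i < n \<and> simple_val x i < 0 \<and> eval_to (x \<circ> sgen i) A' \<and> A = A' \<circ> R i)"
  using assms
proof cases
  case (eval_step y A' i)
  have "simple_val x i < 0"
    using eval_step descent_flip[OF eval_to_Dn[OF eval_step(3)], of i] by simp
  then show ?thesis
    using eval_step by (auto simp: comp_assoc sgen_o_sgen intro!: exI[of _ i] exI[of _ A'])
qed simp

lemma simple_val_id_pos: "0 < simple_val id i"
  by (simp add: simple_val_def)

text \<open>Two descents \<open>i\<close>, \<open>j\<close> of \<open>x\<close> let one strip off the longest element of the dihedral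
  subgroup generated by \<open>s\<^sub>i\<close> and \<open>s\<^sub>j\<close>, along either of its two reduced words; the relations
  for \<open>R\<close> equate the results.\<close>

lemma eval_to_unique:
  assumes "x \<in> Dn n" "eval_to x A" "eval_to x A'"
  shows "A = A'"
  using assms(1) n2 assms(2,3)
proof (induction arbitrary: A A' rule: Dn_descent_induct)
  case (descent x)
  note odd = odd_fun_signed_perms[OF Dn_signed]
  have IH: "D = D'" if "y \<in> Dn n" "pairing n x < pairing n y" "eval_to y D" "eval_to y D'" for y D D'
    using that by (rule descent(2))
  have ev: "eval_to x A" "eval_to x A'" using descent(3,4) .
  show "A = A'"
  proof (cases "x = id")
    case True
    then show ?thesis
      using eval_to_cases[OF ev(1)] eval_to_cases[OF ev(2)] simple_val_id_pos
      by (metis less_asym)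
  next
    case False
    obtain i B where i: "i < n" "simple_val x i < 0" "eval_to (x \<circ> sgen i) B" "A = B \<circ> R i"
      using eval_to_cases[OF ev(1)] False by blast
    obtain j C where j: "j < n" "simple_val x j < 0" "eval_to (x \<circ> sgen j) C" "A' = C \<circ> R j"
      using eval_to_cases[OF ev(2)] False by blast
    have xi: "x \<circ> sgen i \<in> Dn n" "x \<circ> sgen j \<in> Dn n"
      using descent(1) i j n2 by (auto simp: Dn_comp_sgen_iff)
    have uniq: "D = D'" if "k \<in> {i, j}" "eval_to (x \<circ> sgen k) D" "eval_to (x \<circ> sgen k) D'" for k D D'
      using that IH[of "x \<circ> sgen k" D D'] descent_dec[OF descent(1)] xi i j by auto
    consider "i = j" | "i \<noteq> j" "\<not> adjacent i j" | "adjacent i j" by blast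
    then show ?thesis
    proof cases
      case 1
      then show ?thesis using uniq i j by blast
    next
      case 2
      then have 2: "i \<noteq> j" "\<not> adjacent i j" "j \<noteq> i" "\<not> adjacent j i" by (auto simp: adjacent_def)
      have eq: "x \<circ> sgen i \<circ> sgen j = x \<circ> sgen j \<circ> sgen i"
        using sgen_commute[OF 2(1,2)] by (auto simp: fun_eq_iff)
      have v: "simple_val (x \<circ> sgen i) j < 0" "simple_val (x \<circ> sgen j) i < 0"
        using simple_val_commute[OF odd[OF descent(1)]] 2 i j by auto
      obtain D where D: "eval_to (x \<circ> sgen i \<circ> sgen j) D"
        using eval_to_exists[of "x \<circ> sgen i \<circ> sgen j"] xi j n2 by (auto simp: Dn_comp_sgen_iff)
      have "B = D \<circ> R j"
        using uniq[of i] i(3) eval_descent[OF xi(1) j(1) v(1) D] by auto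
      moreover have "C = D \<circ> R i"
        using uniq[of j] j(3) eval_descent[OF xi(2) i(1) v(2)] D eq by auto
      ultimately show ?thesis
        using commute[OF i(1) j(1) 2(1,2)] i j by (simp add: comp_assoc)
    next
      case 3
      then have 3: "adjacent i j" "adjacent j i" by (auto simp: adjacent_def)
      have eq: "x \<circ> sgen i \<circ> sgen j \<circ> sgen i = x \<circ> sgen j \<circ> sgen i \<circ> sgen j"
        using sgen_braid[OF 3(1)] by (auto simp: fun_eq_iff)
      have xij: "x \<circ> sgen i \<circ> sgen j \<in> Dn n" "x \<circ> sgen j \<circ> sgen i \<in> Dn n"
        using xi i j n2 by (auto simp: Dn_comp_sgen_iff)
      have v: "simple_val (x \<circ> sgen i) j < 0" "simple_val (x \<circ> sgen j) i < 0"
        using simple_val_adjacent[OF odd[OF descent(1)]] 3 i j by auto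
      \<comment> \<open>If \<open>x\<close> has values \<open>a\<close> at \<open>i\<close> and
        \<open>b\<close> at \<open>j\<close>, then removing \<open>i\<close> and then
        \<open>j\<close> leaves the value \<open>(a + b) - a = b\<close> at \<open>i\<close>, which
        is still negative.\<close>
      have w: "simple_val (x \<circ> sgen i \<circ> sgen j) i < 0" "simple_val (x \<circ> sgen j \<circ> sgen i) j < 0"
        using simple_val_adjacent[OF odd[OF xi(1)] 3(2)] simple_val_adjacent[OF odd[OF xi(2)] 3(1)]
          simple_val_adjacent[OF odd[OF descent(1)]] 3 i j
          descent_flip[OF descent(1)] by auto
      obtain D where D: "eval_to (x \<circ> sgen i \<circ> sgen j \<circ> sgen i) D"
        using eval_to_exists[of "x \<circ> sgen i \<circ> sgen j \<circ> sgen i"] xij i n2 by (auto simp: Dn_comp_sgen_iff)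
      have "B = D \<circ> R i \<circ> R j"
        using uniq[of i] i(3) eval_descent[OF xi(1) j(1) v(1) eval_descent[OF xij(1) i(1) w(1) D]] by auto
      moreover have "C = D \<circ> R j \<circ> R i"
        using uniq[of j] j(3) eval_descent[OF xi(2) i(1) v(2) eval_descent[OF xij(2) j(1) w(2)]] D eq by auto
      ultimately show ?thesis
        using braid[OF i(1) j(1) 3(1)] i j by (simp add: comp_assoc)
    qed
  qed
qed

definition rep :: "(int \<Rightarrow> int) \<Rightarrow> 'v \<Rightarrow> 'v" where
  "rep x = (THE A. eval_to x A)"

lemma eval_to_rep:
  assumes "x \<in> Dn n"
  shows "eval_to x (rep x)"
  unfolding rep_def using eval_to_exists[OF assms] eval_to_unique[OF assms] by (metis theI)

lemma rep_eqI: "eval_to x A \<Longrightarrow> rep x = A"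
  using eval_to_rep eval_to_unique eval_to_Dn by blast

lemma rep_id: "rep id = pr"
  by (rule rep_eqI) (rule eval_id)

lemma rep_comp_pr:
  assumes "x \<in> Dn n"
  shows "rep x \<circ> pr = rep x"
proof -
  have "pr \<circ> pr = pr" using square[of 0] R_pr[of 0] n2 by (metis comp_assoc zero_less_numeral less_le_trans)
  moreover have "eval_to x A \<Longrightarrow> pr \<circ> pr = pr \<Longrightarrow> A \<circ> pr = A" for A
    by (induction rule: eval_to.induct) (auto simp: comp_assoc R_pr)
  ultimately show ?thesis using eval_to_rep[OF assms] by blast
qed

text \<open>At an ascent this is the defining step; at a descent a word for \<open>x\<close> ends in
  \<open>R i\<close>, and \<open>square\<close> cancels it against the new factor.\<close>

lemma rep_sgen_right:
  assumes "x \<in> Dn n" "i < n"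
  shows "rep (x \<circ> sgen i) = rep x \<circ> R i"
proof (cases "0 < simple_val x i")
  case True
  then show ?thesis using eval_step[OF eval_to_rep[OF assms(1)] assms(2)] by (simp add: rep_eqI)
next
  case False
  then have "simple_val x i < 0"
    using simple_val_nonzero[OF Dn_signed[OF assms(1)] n2, of i] by linarith
  then have "eval_to x (rep (x \<circ> sgen i) \<circ> R i)"
    using eval_descent[OF assms] eval_to_rep assms n2 by (simp add: Dn_comp_sgen_iff)
  then have "rep x \<circ> R i = rep (x \<circ> sgen i) \<circ> (R i \<circ> R i)"
    by (simp add: rep_eqI comp_assoc)
  then show ?thesis using rep_comp_pr assms n2 square by (simp add: Dn_comp_sgen_iff)
qed

lemma rep_comp:
  assumes "x \<in> Dn n" "y \<in> Dn n"
  shows "rep (y \<circ> x) = rep y \<circ> rep x"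
  using assms(1) n2
proof (induction rule: Dn_generated_induct)
  case id
  show "rep (y \<circ> id) = rep y \<circ> rep id" using rep_comp_pr[OF assms(2)] by (simp add: rep_id)
next
  case (step x i)
  have "rep (y \<circ> x) = rep y \<circ> rep x" using step(3) .
  then show "rep (y \<circ> (x \<circ> sgen i)) = rep y \<circ> rep (x \<circ> sgen i)"
    using rep_sgen_right[OF Dn_comp[OF assms(2) step(1)] step(2)] rep_sgen_right[OF step(1,2)]
    by (simp add: comp_assoc)
qed

lemma rep_sgen:
  assumes "i < n"
  shows "rep (sgen i) = R i"
  using rep_sgen_right[OF Dn_id assms] pr_R[OF assms] by (simp add: rep_id)

end

text \<open>Gaussian elimination: one equation with a nonzero coefficient is solved for the pivot
  unknown \<open>z\<close>, which is then substituted into the others. This is how the comparison of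
  dimensions becomes an existence statement.\<close>

lemma homogeneous_system_solution:
  fixes a :: "'e \<Rightarrow> 'a \<Rightarrow> real"
  assumes "finite E" "finite A" "card E < card A"
  shows "\<exists>v. (\<exists>x\<in>A. v x \<noteq> 0) \<and> (\<forall>e\<in>E. (\<Sum>x\<in>A. a e x * v x) = 0)"
  using assms
proof (induction E arbitrary: A a rule: finite_induct)
  case empty
  then have "A \<noteq> {}" by auto
  then show ?case by (intro exI[of _ "\<lambda>_. 1"]) auto
next
  case (insert e E)
  show ?case
  proof (cases "\<forall>x\<in>A. a e x = 0")
    case True
    then show ?thesis using insert.IH[of A a] insert.prems insert.hyps by auto
  next
    case False
    then obtain z where z: "z \<in> A" "a e z \<noteq> 0" by blast
    define A' where "A' = A - {z}"
    have A': "finite A'" "card E < card A'" "A = insert z A'" "z \<notin> A'"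
      using insert z by (auto simp: A'_def)
    obtain v where v: "\<exists>x\<in>A'. v x \<noteq> 0"
      "\<forall>e'\<in>E. (\<Sum>x\<in>A'. (a e' x - a e' z * a e x / a e z) * v x) = 0"
      using insert.IH[OF A'(1,2), of "\<lambda>e' x. a e' x - a e' z * a e x / a e z"] by blast
    define s where "s = (\<Sum>x\<in>A'. a e x * v x)"
    define w where "w = v(z := - s / a e z)"
    have wsum: "(\<Sum>x\<in>A. a e' x * w x) = (\<Sum>x\<in>A'. a e' x * v x) - a e' z * s / a e z" for e'
    proof -
      have "(\<Sum>x\<in>A'. a e' x * w x) = (\<Sum>x\<in>A'. a e' x * v x)"
        by (rule sum.cong) (use A'(4) in \<open>auto simp: w_def\<close>)
      then show ?thesis unfolding A'(3) using A'(1,4) by (simp add: w_def)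
    qed
    have "(\<Sum>x\<in>A'. (a e' x - a e' z * a e x / a e z) * v x)
        = (\<Sum>x\<in>A'. a e' x * v x) - a e' z * s / a e z" for e'
      by (simp add: s_def left_diff_distrib sum_subtractf sum_distrib_left sum_divide_distrib mult.assoc)
    with v(2) have "\<forall>e'\<in>E. (\<Sum>x\<in>A. a e' x * w x) = 0" by (simp add: wsum)
    moreover have "(\<Sum>x\<in>A. a e x * w x) = 0" using z by (simp add: wsum s_def)
    moreover have "\<exists>x\<in>A. w x \<noteq> 0" using v(1) A' by (auto simp: w_def)
    ultimately show ?thesis by blast
  qed
qed

section \<open>Contents of skew tableaux\<close>

text \<open>The identity in case (1), the sign change of 1 in case (2). Conjugation by it turns
  \<open>s_1\<close> into \<open>s_0\<close> and fixes \<open>s_i\<close> for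
  \<open>i \<ge> 2\<close>, which \<open>gidx\<close> records.\<close>

definition flip1 :: "bool \<Rightarrow> int \<Rightarrow> int" where
  "flip1 pos k = (if \<not> pos \<and> \<bar>k\<bar> = 1 then - k else k)"

definition gidx :: "bool \<Rightarrow> nat \<Rightarrow> nat" where
  "gidx pos i = (if \<not> pos \<and> i = 1 then 0 else i)"

lemma flip1_flip1 [simp]: "flip1 pos (flip1 pos k) = k"
  by (simp add: flip1_def)

lemma flip1_0 [simp]: "flip1 pos 0 = 0"
  by (simp add: flip1_def)

lemma flip1_signed: "1 \<le> n \<Longrightarrow> flip1 pos \<in> signed_perms n"
  by (rule involution_signed_perm) (auto simp: flip1_def signed_set_iff)

lemma sign_prod_flip1:
  assumes "1 \<le> n"
  shows "sign_prod n (flip1 pos) = (if pos then 1 else -1)"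
proof -
  have "{k \<in> {1..int n}. flip1 pos k < 0} = (if pos then {} else {1})"
    using assms by (auto simp: flip1_def split: if_splits)
  moreover have "\<forall>k\<in>{1..int n}. flip1 pos k \<noteq> 0" by (auto simp: flip1_def)
  ultimately show ?thesis
    unfolding sign_prod_def by (subst prod_sgn_eq_power) auto
qed

lemma sgen_gidx_flip1:
  assumes "1 \<le> i" "0 \<le> k"
  shows "sgen (gidx pos i) (flip1 pos k) = flip1 pos (transp (int i) k)"
  using assms by (auto simp: sgen_def flip1_def gidx_def transp_def Let_def)

lemma sgen_gidx_flip1_signed:
  assumes "1 \<le> i"
  shows "sgen (gidx pos i) (flip1 pos k) = flip1 pos (sgen i k)"
  using assms by (auto simp: sgen_def flip1_def gidx_def Let_def)

text \<open>1 is the least positive integer, and its replacement \<open>-1\<close> still lies below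
  all others.\<close>

lemma flip1_less_iff:
  assumes "0 < a" "0 < b"
  shows "flip1 pos a < flip1 pos b \<longleftrightarrow> a < b"
  using assms by (auto simp: flip1_def)

lemma transp_transp [simp]: "transp i (transp i k) = k"
  by (simp add: transp_def)

text \<open>An inverted pair is so tight that any integer strictly between is 0 or shares an
  absolute value with \<open>a\<close> or \<open>b\<close>. This forces neighbouring cells when
  \<open>T^s\<close> is not standard.\<close>

lemma sgen_inversion:
  assumes "a < b" "a \<noteq> 0" "b \<noteq> 0" "\<bar>a\<bar> \<noteq> \<bar>b\<bar>" "\<not> sgen i a < sgen i b"
  shows "if i = 0 then (a = -2 \<and> b = 1) \<or> (a = -1 \<and> b = 2)
    else (a = int i \<and> b = int i + 1) \<or> (a = - int i - 1 \<and> b = - int i)"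
proof (cases "i = 0")
  case True
  then show ?thesis using assms by (auto simp: sgen_def split: if_splits)
next
  case False
  have val: "sgen i k = (if k = int i then int i + 1 else if k = int i + 1 then int i
      else if k = - int i then - int i - 1 else if k = - int i - 1 then - int i else k)" for k
    using False by (simp add: sgen_def)
  show ?thesis using False assms unfolding val by (smt (verit) of_nat_0_less_iff)
qed

section \<open>Convexity of skew shapes\<close>

definition convex_cells :: "cell set \<Rightarrow> bool" where
  "convex_cells A \<longleftrightarrow> (\<forall>r c r' c' a b. (r, c) \<in> A \<longrightarrow> (r', c') \<in> A \<longrightarrow> r \<le> a \<longrightarrow> a \<le> r' \<longrightarrow>
     c \<le> b \<longrightarrow> b \<le> c' \<longrightarrow> (a, b) \<in> A)"

lemma convex_cellsD:
  "convex_cells A \<Longrightarrow> (r, c) \<in> A \<Longrightarrow> (r', c') \<in> A \<Longrightarrow> r \<le> a \<Longrightarrow> a \<le> r' \<Longrightarrow> c \<le> b \<Longrightarrow> b \<le> c' \<Longrightarrow> (a, b) \<in> A"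
  unfolding convex_cells_def by blast

text \<open>A difference of two down-sets of the product order is order convex. The skew shape
  enters later arguments in this form, which survives translation.\<close>

lemma skew_shape_convex:
  assumes "skew_shape S"
  shows "convex_cells S"
proof -
  obtain Y Z where YZ: "young_diagram Y" "young_diagram Z" "S = Y - Z"
    using assms by (auto simp: skew_shape_def)
  show ?thesis
    unfolding convex_cells_def
  proof (intro allI impI)
    fix r c r' c' a b
    assume h: "(r, c) \<in> S" "(r', c') \<in> S" "r \<le> a" "a \<le> r'" "c \<le> b" "b \<le> c'"
    have rc: "0 \<le> r" "0 \<le> c" using h(1) YZ by (auto simp: young_diagram_def)
    have "(a, b) \<in> Y" using h rc YZ unfolding young_diagram_def by (meson DiffD1 order_trans)
    moreover have "(a, b) \<notin> Z"
    proof
      assume "(a, b) \<in> Z"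
      then have "(r, c) \<in> Z" using h rc YZ(2) unfolding young_diagram_def by blast
      with h(1) YZ(3) show False by blast
    qed
    ultimately show "(a, b) \<in> S" using YZ(3) by blast
  qed
qed

lemma standard_onD:
  "standard_on A T \<Longrightarrow> (i, j) \<in> A \<Longrightarrow> (i', j') \<in> A \<Longrightarrow> (i = i' \<and> j < j') \<or> (j = j' \<and> i < i')
    \<Longrightarrow> T (i, j) < T (i', j')"
  unfolding standard_on_def by blast

text \<open>The two cells are opposite corners of a rectangle; convexity supplies the other two
  corners, whose entries lie in between. Having two such cells, not just one, is what excludes
  \<open>f_i + f_j = 0\<close>.\<close>

lemma same_diagonal_gap:
  assumes "convex_cells A" "standard_on A T" "p \<in> A" "q \<in> A" "content p = content q" "T p < T q"
  shows "\<exists>x\<in>A. \<exists>y\<in>A. x \<noteq> y \<and> T p < T x \<and> T x < T q \<and> T p < T y \<and> T y < T q"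
proof -
  obtain r c r' c' where pq: "p = (r, c)" "q = (r', c')" by (metis surj_pair)
  have diag: "c' - c = r' - r" using assms(5) pq by (simp add: content_def)
  have main: "\<exists>x\<in>A. \<exists>y\<in>A. x \<noteq> y \<and> T (a, b) < T x \<and> T x < T (a', b') \<and> T (a, b) < T y \<and> T y < T (a', b')"
    if h: "(a, b) \<in> A" "(a', b') \<in> A" "a < a'" "b < b'" for a b a' b'
  proof -
    have "(a, b') \<in> A" "(a', b) \<in> A"
      using convex_cellsD[OF assms(1) h(1,2), of a b'] convex_cellsD[OF assms(1) h(1,2), of a' b] h(3,4) by simp_all
    moreover have "(a, b') \<noteq> (a', b)" using h by auto
    moreover have "T (a, b) < T (a, b')" "T (a, b') < T (a', b')" "T (a, b) < T (a', b)" "T (a', b) < T (a', b')"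
      by (rule standard_onD[OF assms(2)]; use h calculation in simp)+
    ultimately show ?thesis by blast
  qed
  consider "r < r'" | "r = r'" | "r' < r" by linarith
  then show ?thesis
  proof cases
    case 1
    then show ?thesis using main[of r c r' c'] assms pq diag by auto
  next
    case 2
    then show ?thesis using assms pq diag by simp
  next
    case 3
    then show ?thesis using main[of r' c' r c] assms pq diag by force
  qed
qed

section \<open>Two-term matrices and the braid identity\<close>

lemma matop_swap:
  fixes F :: "tab \<Rightarrow> real"
  assumes "finite B" "U \<in> B" "\<And>T. s (s T) = T"
  shows "matop B (\<lambda>U T. let f = F T in (if U = T then 1 / f else 0) +
      (if U = s T then sqrt (1 - 1 / f\<^sup>2) else 0)) v U =
    v U / F U + (if s U \<in> B then sqrt (1 - 1 / (F (s U))\<^sup>2) * v (s U) else 0)"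
proof -
  \<comment> \<open>Row \<open>U\<close> of the matrix meets only the columns \<open>U\<close> and
    \<open>s U\<close>; the off-diagonal coefficient is therefore evaluated at
    \<open>s U\<close>.\<close>
  have eq: "U = s T \<longleftrightarrow> s U = T" for T using assms(3) by metis
  have "(\<Sum>T\<in>B. ((if U = T then 1 / F T else 0) + (if U = s T then sqrt (1 - 1 / (F T)\<^sup>2) else 0)) * v T)
    = (\<Sum>T\<in>B. if U = T then v T / F T else 0) + (\<Sum>T\<in>B. if s U = T then sqrt (1 - 1 / (F T)\<^sup>2) * v T else 0)"
    unfolding eq sum.distrib[symmetric] by (rule sum.cong) (auto simp: distrib_right)
  also have "\<dots> = v U / F U + (if s U \<in> B then sqrt (1 - 1 / (F (s U))\<^sup>2) * v (s U) else 0)"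
    using assms(1,2) by (simp add: sum.delta')
  finally show ?thesis using assms(2) by (simp add: matop_def Let_def)
qed

lemma matop_linear:
  "matop B M (\<lambda>U. a * v U + b * w U) = (\<lambda>U. a * matop B M v U + b * matop B M w U)"
  by (auto simp: matop_def fun_eq_iff sum_distrib_left sum.distrib[symmetric] algebra_simps intro!: sum.cong)

text \<open>\<open>v, vi, vj, vij, vji, w\<close> are the coordinates of a vector at
  \<open>U\<close> and its images under words in \<open>s_i, s_j\<close>; \<open>x, y, z\<close> are
  off-diagonal coefficients. The terms in \<open>vi\<close>, \<open>vj\<close> match by
  \<open>1/(ab) = 1/(ac) + 1/(bc)\<close>, those in \<open>v\<close> by the values of
  \<open>x^2\<close> and \<open>y^2\<close>.\<close>

lemma braid_identity:
  fixes a b c x y z :: real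
  assumes c: "c = a + b" and nz: "a \<noteq> 0" "b \<noteq> 0" "c \<noteq> 0"
    and sq: "x\<^sup>2 = 1 - 1 / a\<^sup>2" "y\<^sup>2 = 1 - 1 / b\<^sup>2"
  shows "((v / a + x * vi) / b + y * (vj / c + z * vij)) / a
      + x * ((vi / (- a) + x * v) / c + z * (vji / b + y * w))
    = ((v / b + y * vj) / a + x * (vi / c + z * vji)) / b
      + y * ((vj / (- b) + y * v) / c + z * (vij / a + x * w))"
proof -
  have "c * (1 / (a * b) / a - 1 / (a * b) / b) = 1 / a\<^sup>2 - 1 / b\<^sup>2"
    unfolding c using nz by (simp add: field_simps power2_eq_square)
  then have "1 / (a * b) / a - 1 / (a * b) / b = (1 / a\<^sup>2 - 1 / b\<^sup>2) / c"
    using nz by (simp add: eq_divide_eq mult.commute)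
  then have 1: "1 / (a * b) / a + (1 - 1 / a\<^sup>2) / c = 1 / (a * b) / b + (1 - 1 / b\<^sup>2) / c"
    by (simp add: diff_divide_distrib)
  have "1 / (a * c) + 1 / (b * c) = (a + b) / (a * b * c)"
    using nz by (simp add: field_simps)
  then have 2: "1 / (a * b) - 1 / (a * c) = 1 / (b * c)" "1 / (a * b) - 1 / (b * c) = 1 / (a * c)"
    using nz unfolding c by simp_all
  have "((v / a + x * vi) / b + y * (vj / c + z * vij)) / a
      + x * ((vi / (- a) + x * v) / c + z * (vji / b + y * w))
    = v * (1 / (a * b) / a + x\<^sup>2 / c) + x * vi * (1 / (a * b) - 1 / (a * c))
      + y * vj * (1 / (a * c)) + y * z * vij / a + x * z * vji / b + x * y * z * w"
    by (simp add: add_divide_distrib diff_divide_distrib power2_eq_square algebra_simps)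
  also have "\<dots> = v * (1 / (a * b) / b + y\<^sup>2 / c) + x * vi * (1 / (b * c))
      + y * vj * (1 / (a * b) - 1 / (b * c)) + y * z * vij / a + x * z * vji / b + x * y * z * w"
    unfolding sq 1 2 ..
  also have "\<dots> = ((v / b + y * vj) / a + x * (vi / c + z * vji)) / b
      + y * ((vj / (- b) + y * v) / c + z * (vij / a + x * w))"
    by (simp add: add_divide_distrib diff_divide_distrib power2_eq_square algebra_simps)
  finally show ?thesis .
qed

section \<open>Fillings and their content vectors\<close>

definition filling :: "cell set \<Rightarrow> nat \<Rightarrow> tab \<Rightarrow> bool" where
  "filling A n T \<longleftrightarrow> (\<forall>c. c \<notin> A \<longrightarrow> T c = 0) \<and> (\<forall>c\<in>A. T c \<noteq> 0 \<and> \<bar>T c\<bar> \<le> int n) \<and> inj_on (\<lambda>c. \<bar>T c\<bar>) A"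

text \<open>The content vector, set to \<open>0\<close> outside \<open>\<plusminus>{1,\<dots>,n}\<close>, where \<open>cD\<close> takes junk values
  that are not odd.\<close>

definition cvec :: "cell set \<Rightarrow> nat \<Rightarrow> tab \<Rightarrow> int \<Rightarrow> int" where
  "cvec A n T k = (if k \<in> signed_set n then cD A T k else 0)"

text \<open>Standardness is left out of \<open>filling\<close> so that \<open>T^s\<close> remains a
  filling even when it is not standard, and identities between contents can be applied along whole
  words.\<close>

lemma filling_comp:
  assumes "filling A n T" "\<pi> \<in> signed_perms n"
  shows "filling A n (\<pi> \<circ> T)"
  using assms signed_perms_zero[OF assms(2)] signed_perms_nonzero[OF assms(2)]
    signed_perms_abs_le_iff[OF assms(2)] signed_perms_abs_eq_iff[OF assms(2)]
  by (auto simp: filling_def inj_on_def)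

lemma cD_sgen: "cD A (sgen i \<circ> T) k = cD A T (sgen i k)"
proof -
  have "sgen i (T c) = k \<longleftrightarrow> T c = sgen i k" "sgen i (T c) = - k \<longleftrightarrow> T c = - sgen i k" for c
    by (simp_all add: sgen_eq_iff sgen_minus)
  then show ?thesis by (simp add: cD_def)
qed

lemma cD_entry:
  assumes "filling A n T" "p \<in> A"
  shows "cD A T (T p) = content p"
proof -
  have "(THE c. c \<in> A \<and> T c = T p) = p"
    using assms by (intro the_equality) (auto simp: filling_def inj_on_def)
  then show ?thesis using assms by (auto simp: cD_def)
qed

lemma cD_neg_entry:
  assumes "filling A n T" "p \<in> A"
  shows "cD A T (- T p) = - content p"
proof -
  have "(THE c. c \<in> A \<and> T c = T p) = p"
    using assms by (intro the_equality) (auto simp: filling_def inj_on_def)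
  moreover have "\<not> (\<exists>c\<in>A. T c = - T p)"
  proof
    assume "\<exists>c\<in>A. T c = - T p"
    then obtain c where c: "c \<in> A" "T c = - T p" by blast
    then have "c = p" using assms by (auto simp: filling_def inj_on_def)
    with c assms show False by (auto simp: filling_def)
  qed
  ultimately show ?thesis by (simp add: cD_def)
qed

lemma filling_abs_bij:
  assumes "filling A n T" "finite A" "card A = n"
  shows "bij_betw (\<lambda>c. \<bar>T c\<bar>) A {1..int n}"
proof -
  have inj: "inj_on (\<lambda>c. \<bar>T c\<bar>) A" using assms by (simp add: filling_def)
  have sub: "(\<lambda>c. \<bar>T c\<bar>) ` A \<subseteq> {1..int n}" using assms(1) by (force simp: filling_def)
  have "(\<lambda>c. \<bar>T c\<bar>) ` A = {1..int n}"
    by (rule card_subset_eq) (use sub card_image[OF inj] assms(3) in auto)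
  with inj show ?thesis by (simp add: bij_betw_def)
qed

lemma filling_cell:
  assumes "filling A n T" "finite A" "card A = n" "k \<in> signed_set n"
  obtains p where "p \<in> A" "T p = k \<or> T p = - k"
proof -
  have "\<bar>k\<bar> \<in> (\<lambda>c. \<bar>T c\<bar>) ` A"
    using filling_abs_bij[OF assms(1-3)] assms(4) by (auto simp: bij_betw_def signed_set_iff)
  then show ?thesis using that by (auto simp: abs_eq_iff)
qed

lemma odd_fun_cvec:
  assumes "filling A n T" "finite A" "card A = n"
  shows "odd_fun (cvec A n T)"
  unfolding odd_fun_def
proof
  fix k
  show "cvec A n T (- k) = - cvec A n T k"
  proof (cases "k \<in> signed_set n")
    case True
    then obtain p where "p \<in> A" "T p = k \<or> T p = - k" using filling_cell[OF assms] by blast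
    then show ?thesis
      using cD_entry[OF assms(1), of p] cD_neg_entry[OF assms(1), of p] True
      by (auto simp: cvec_def signed_set_iff)
  next
    case False
    then show ?thesis by (auto simp: cvec_def signed_set_iff)
  qed
qed

lemma cvec_sgen:
  assumes "i < n" "2 \<le> n"
  shows "cvec A n (sgen i \<circ> T) = cvec A n T \<circ> sgen i"
  using signed_perms_mem_iff[OF Dn_signed[OF sgen_Dn[OF assms]]] by (auto simp: cvec_def cD_sgen)

lemma fD_eq_simple_val:
  assumes "i < n" "2 \<le> n"
  shows "fD A T i = simple_val (cvec A n T) i"
  using assms by (auto simp: fD_def simple_val_def cvec_def signed_set_iff)

lemma finite_fillings:
  assumes "finite A"
  shows "finite {T. filling A n T}"
proof (rule finite_subset)
  show "{T. filling A n T} \<subseteq> {T. \<forall>c. (c \<in> A \<longrightarrow> T c \<in> {- int n..int n}) \<and> (c \<notin> A \<longrightarrow> T c = 0)}"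
    by (auto simp: filling_def abs_le_iff)
  show "finite {T. \<forall>c. (c \<in> A \<longrightarrow> T c \<in> {- int n..int n}) \<and> (c \<notin> A \<longrightarrow> T c = (0::int))}"
    by (rule finite_set_of_finite_funs) (auto simp: assms)
qed

section \<open>D-Young tableaux of a fixed shape and sign\<close>

locale D_tableaux =
  fixes S :: "cell set" and m :: nat and pos :: bool
  assumes skew: "skew_shape S" and card2: "2 \<le> card S" and m1: "1 \<le> m"
begin

abbreviation "n \<equiv> card S"
abbreviation "P \<equiv> place S (int m)"
abbreviation "B \<equiv> Dtabs S m pos"
abbreviation "offset \<equiv> int m - Min (content ` S)"

definition unshift :: "cell \<Rightarrow> cell" where
  "unshift c = (fst c, snd c - offset)"

definition f :: "nat \<Rightarrow> tab \<Rightarrow> int" where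
  "f i T = simple_val (cvec P n T) i"

definition g :: "nat \<Rightarrow> tab \<Rightarrow> real" where
  "g i T = sqrt (1 - 1 / (real_of_int (f i T))\<^sup>2)"

lemma finite_S: "finite S"
  using card2 by (metis card.infinite not_numeral_le_zero)

lemma place_iff: "c \<in> P \<longleftrightarrow> unshift c \<in> S"
  by (cases c) (force simp: place_def unshift_def)

lemma bij_unshift: "bij_betw unshift P S"
  by (rule bij_betw_byWitness[where f' = "\<lambda>(i, j). (i, j + offset)"])
    (auto simp: place_iff, auto simp: unshift_def)

lemma finite_P: "finite P" and card_P: "card P = n"
  using bij_betw_finite[OF bij_unshift] bij_betw_same_card[OF bij_unshift] finite_S by auto

lemma content_unshift: "content (unshift c) = content c - offset"
  by (simp add: content_def unshift_def)

lemma content_P_pos: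
  assumes "c \<in> P"
  shows "1 \<le> content c"
proof -
  have "Min (content ` S) \<le> content (unshift c)"
    using assms finite_S by (simp add: place_iff)
  then show ?thesis using m1 by (simp add: content_unshift)
qed

lemma convex_S: "convex_cells S"
  using skew_shape_convex[OF skew] .

lemma convex_P: "convex_cells P"
  unfolding convex_cells_def
proof (intro allI impI)
  fix r c r' c' a b
  assume "(r, c) \<in> P" "(r', c') \<in> P" "r \<le> a" "a \<le> r'" "c \<le> b" "b \<le> c'"
  then show "(a, b) \<in> P"
    using convex_cellsD[OF convex_S, of r "c - offset" r' "c' - offset" a "b - offset"]
    by (simp add: place_iff unshift_def)
qed

text \<open>The parity condition in multiplicative form: the sign product is 1 in case (1) and
  \<open>-1\<close> in case (2), which is the sign of the flip in both.\<close>

lemma B_iff: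
  "T \<in> B \<longleftrightarrow> filling P n T \<and> standard_on P T \<and> (\<Prod>c\<in>P. sgn (T c)) = sign_prod n (flip1 pos)"
proof -
  have "(even (card {c \<in> P. T c < 0}) \<longleftrightarrow> pos) \<longleftrightarrow> (\<Prod>c\<in>P. sgn (T c)) = sign_prod n (flip1 pos)"
    if "filling P n T"
  proof -
    have "(\<Prod>c\<in>P. sgn (T c)) = (-1) ^ card {c \<in> P. T c < 0}"
      by (rule prod_sgn_eq_power) (use that finite_P in \<open>auto simp: filling_def\<close>)
    then show ?thesis using sign_prod_flip1[of n pos] card2 by (simp add: minus_one_power_iff)
  qed
  then show ?thesis unfolding Dtabs_def Let_def filling_def by auto
qed

lemma finite_B: "finite B"
  by (rule finite_subset[OF _ finite_fillings[OF finite_P, of n]]) (auto simp: B_iff)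

lemma B_filling: "T \<in> B \<Longrightarrow> filling P n T"
  by (simp add: B_iff)

lemma filling_sgen: "filling P n T \<Longrightarrow> i < n \<Longrightarrow> filling P n (sgen i \<circ> T)"
  using filling_comp Dn_signed[OF sgen_Dn] card2 by blast

lemma prod_sgn_comp:
  assumes "filling P n T" "\<pi> \<in> signed_perms n"
  shows "(\<Prod>c\<in>P. sgn ((\<pi> \<circ> T) c)) = (\<Prod>c\<in>P. sgn (T c)) * sign_prod n \<pi>"
  using prod_sgn_signed_perm[OF assms(2) filling_abs_bij[OF assms(1) finite_P card_P]] by simp

lemma comp_Dn_in_B:
  assumes "T \<in> B" "\<pi> \<in> Dn n" "standard_on P (\<pi> \<circ> T)"
  shows "\<pi> \<circ> T \<in> B"
  using assms prod_sgn_comp[of T \<pi>] filling_comp[of P n T \<pi>] by (simp add: B_iff Dn_iff)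

lemma cvec_entry:
  assumes "filling P n T" "p \<in> P"
  shows "cvec P n T (T p) = content p" "cvec P n T (- T p) = - content p"
  using assms cD_entry[OF assms] cD_neg_entry[OF assms]
  by (auto simp: cvec_def signed_set_iff filling_def)

lemma odd_cvec: "filling P n T \<Longrightarrow> odd_fun (cvec P n T)"
  using odd_fun_cvec finite_P card_P by blast

text \<open>Since all cells have positive content, \<open>a\<close> and \<open>b\<close> occur
  either both as themselves or both as their negatives, hence in cells of one diagonal. There
  \<open>same_diagonal_gap\<close> applies, with the order reversed in the second case.\<close>

lemma equal_content_gap:
  assumes T: "T \<in> B" and ab: "a \<in> signed_set n" "b \<in> signed_set n" "\<bar>a\<bar> \<noteq> \<bar>b\<bar>" "a < b"
    and eq: "cvec P n T a = cvec P n T b"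
  shows "\<exists>u v. a < u \<and> u < b \<and> a < v \<and> v < b \<and> \<bar>u\<bar> \<noteq> \<bar>v\<bar> \<and> u \<noteq> 0 \<and> v \<noteq> 0 \<and>
    \<bar>u\<bar> \<noteq> \<bar>a\<bar> \<and> \<bar>u\<bar> \<noteq> \<bar>b\<bar> \<and> \<bar>v\<bar> \<noteq> \<bar>a\<bar> \<and> \<bar>v\<bar> \<noteq> \<bar>b\<bar>"
proof -
  note F = B_filling[OF T]
  have std: "standard_on P T" using T by (simp add: B_iff)
  obtain p where p: "p \<in> P" "T p = a \<or> T p = - a" using filling_cell[OF F finite_P card_P ab(1)] .
  obtain q where q: "q \<in> P" "T q = b \<or> T q = - b" using filling_cell[OF F finite_P card_P ab(2)] .
  have inj: "\<bar>T x\<bar> \<noteq> \<bar>T y\<bar>" if "x \<in> P" "y \<in> P" "x \<noteq> y" for x y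
    using F that by (auto simp: filling_def inj_on_def)
  have nz: "T x \<noteq> 0" if "x \<in> P" for x using F that by (simp add: filling_def)
  have cp: "1 \<le> content p" "1 \<le> content q" using content_P_pos p q by auto
  have cnt: "cvec P n T a = (if T p = a then content p else - content p)"
    "cvec P n T b = (if T q = b then content q else - content q)"
    using cvec_entry[OF F p(1)] cvec_entry[OF F q(1)] p q by auto
  consider (pp) "T p = a" "T q = b" "content p = content q" | (nn) "T p = - a" "T q = - b" "content p = content q"
    using p q cnt eq cp by (auto split: if_splits)
  then show ?thesis
  proof cases
    case pp
    then obtain x y where xy: "x \<in> P" "y \<in> P" "x \<noteq> y" "T p < T x" "T x < T q" "T p < T y" "T y < T q"
      using same_diagonal_gap[OF convex_P std p(1) q(1)] ab by auto
    then have "x \<noteq> p" "x \<noteq> q" "y \<noteq> p" "y \<noteq> q" by auto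
    with xy p(1) q(1) inj nz pp show ?thesis by metis
  next
    case nn
    then obtain x y where xy: "x \<in> P" "y \<in> P" "x \<noteq> y" "T q < T x" "T x < T p" "T q < T y" "T y < T p"
      using same_diagonal_gap[OF convex_P std q(1) p(1)] ab by auto
    then have ne: "x \<noteq> p" "x \<noteq> q" "y \<noteq> p" "y \<noteq> q" by auto
    have "a < - T x" "- T x < b" "a < - T y" "- T y < b" using xy nn by auto
    moreover have "\<bar>- T x\<bar> \<noteq> \<bar>- T y\<bar>" "- T x \<noteq> 0" "- T y \<noteq> 0"
      using inj[OF xy(1-3)] nz xy by auto
    moreover have "\<bar>- T x\<bar> \<noteq> \<bar>a\<bar>" "\<bar>- T x\<bar> \<noteq> \<bar>b\<bar>" "\<bar>- T y\<bar> \<noteq> \<bar>a\<bar>" "\<bar>- T y\<bar> \<noteq> \<bar>b\<bar>"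
      using inj[OF xy(1) p(1) ne(1)] inj[OF xy(1) q(1) ne(2)] inj[OF xy(2) p(1) ne(3)]
        inj[OF xy(2) q(1) ne(4)] nn by auto
    ultimately show ?thesis by blast
  qed
qed

lemma cvec_neg_one:
  assumes "T \<in> B"
  shows "cvec P n T (- 1) = - cvec P n T 1"
  using odd_cvec[OF B_filling[OF assms]] by (simp add: odd_fun_def)

text \<open>\<open>f_0 = 0\<close> reads \<open>c_{-1} = c_2\<close>; the pair \<open>-1, 2\<close>,
  like \<open>i, i+1\<close>, leaves no admissible value in between.\<close>

lemma f_nonzero:
  assumes "T \<in> B" "i < n"
  shows "f i T \<noteq> 0"
proof
  assume z: "f i T = 0"
  show False
  proof (cases "i = 0")
    case True
    have "cvec P n T (- 1) = cvec P n T 2"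
      using z True cvec_neg_one[OF assms(1)] by (simp add: f_def simple_val_def)
    then show False
      using equal_content_gap[OF assms(1), of "-1" 2] card2 by (auto simp: signed_set_iff)
  next
    case False
    have "cvec P n T (int i) = cvec P n T (int i + 1)"
      using z False by (simp add: f_def simple_val_def)
    then show False
      using equal_content_gap[OF assms(1), of "int i" "int i + 1"] assms(2) False
      by (auto simp: signed_set_iff)
  qed
qed

text \<open>The sum is the difference of contents for \<open>i, i+2\<close> or for
  \<open>-1, 3\<close>. Only one admissible absolute value lies in between, while equal contents
  would demand two.\<close>

lemma f_sum_nonzero:
  assumes "T \<in> B" "i < n" "j < n" "adjacent i j"
  shows "f i T + f j T \<noteq> 0"
proof -
  have *: "f i T + f j T \<noteq> 0" if ij: "i < n" "j < n" "(0 < i \<and> j = Suc i) \<or> (i = 0 \<and> j = 2)" for i j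
  proof
    assume z: "f i T + f j T = 0"
    show False
    proof (cases "i = 0")
      case True
      have "cvec P n T (- 1) = cvec P n T 3"
        using z True ij cvec_neg_one[OF assms(1)] by (simp add: f_def simple_val_def)
      then obtain u v :: int where "-1 < u" "u < 3" "-1 < v" "v < 3" "\<bar>u\<bar> \<noteq> \<bar>v\<bar>" "u \<noteq> 0" "v \<noteq> 0"
        "\<bar>u\<bar> \<noteq> \<bar>- 1\<bar>" "\<bar>v\<bar> \<noteq> \<bar>- 1\<bar>"
        using equal_content_gap[OF assms(1), of "-1" 3] ij True by (auto simp: signed_set_iff)
      then show False by auto
    next
      case False
      have "cvec P n T (int i) = cvec P n T (int i + 2)"
        using z False ij by (simp add: f_def simple_val_def add.commute)
      then obtain u v where "int i < u" "u < int i + 2" "int i < v" "v < int i + 2" "\<bar>u\<bar> \<noteq> \<bar>v\<bar>"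
        using equal_content_gap[OF assms(1), of "int i" "int i + 2"] ij False by (auto simp: signed_set_iff)
      then show False by auto
    qed
  qed
  from *[of i j] *[of j i] assms show ?thesis by (auto simp: adjacent_def add.commute)
qed

text \<open>A pair of cells violating standardness was inverted by \<open>s_i\<close>. No entry fits
  between its two entries, so by convexity the cells are neighbours, and \<open>f_i\<close> is the
  difference of their contents.\<close>

lemma f_eq_one_if_nonstandard:
  assumes "T \<in> B" "i < n" "sgen i \<circ> T \<notin> B"
  shows "\<bar>f i T\<bar> = 1"
proof -
  note F = B_filling[OF assms(1)]
  have std: "standard_on P T" using assms by (simp add: B_iff)
  have "\<not> standard_on P (sgen i \<circ> T)"
    using comp_Dn_in_B[OF assms(1) sgen_Dn[OF assms(2) card2]] assms(3) by blast
  then obtain r c r' c' where rc: "(r, c) \<in> P" "(r', c') \<in> P" "(r = r' \<and> c < c') \<or> (c = c' \<and> r < r')"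
    "\<not> sgen i (T (r, c)) < sgen i (T (r', c'))"
    unfolding standard_on_def by auto
  define a b where "a = T (r, c)" and "b = T (r', c')"
  have inj: "\<bar>T x\<bar> \<noteq> \<bar>T y\<bar>" if "x \<in> P" "y \<in> P" "x \<noteq> y" for x y
    using F that by (auto simp: filling_def inj_on_def)
  have nz: "T x \<noteq> 0" if "x \<in> P" for x using F that by (simp add: filling_def)
  have ab: "a < b" "a \<noteq> 0" "b \<noteq> 0" "\<bar>a\<bar> \<noteq> \<bar>b\<bar>"
    using standard_onD[OF std rc(1-3)] nz rc inj[of "(r, c)" "(r', c')"] by (auto simp: a_def b_def)
  note inv = sgen_inversion[OF ab, of i, folded a_def b_def, OF rc(4)[folded a_def b_def]]
  have nogap: False if x: "x \<in> P" "a < T x" "T x < b" for x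
  proof -
    have "x \<noteq> (r, c)" "x \<noteq> (r', c')" using x by (auto simp: a_def b_def)
    then have "\<bar>T x\<bar> \<noteq> \<bar>a\<bar>" "\<bar>T x\<bar> \<noteq> \<bar>b\<bar>" using inj x rc by (auto simp: a_def b_def)
    with x nz[OF x(1)] inv show False by (auto split: if_splits)
  qed
  have "\<bar>content (r', c') - content (r, c)\<bar> = 1"
  proof (cases "r = r'")
    case True
    have "c' = c + 1"
    proof (rule ccontr)
      assume "c' \<noteq> c + 1"
      with rc True have lt: "c + 1 < c'" by auto
      have "(r, c + 1) \<in> P" using convex_cellsD[OF convex_P rc(1,2), of r "c + 1"] True lt by auto
      with nogap standard_onD[OF std] rc True lt show False unfolding a_def b_def by (metis less_add_one)
    qed
    with True show ?thesis by (simp add: content_def)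
  next
    case False
    then have cc: "c = c'" "r < r'" using rc by auto
    have "r' = r + 1"
    proof (rule ccontr)
      assume "r' \<noteq> r + 1"
      with cc have lt: "r + 1 < r'" by auto
      have "(r + 1, c) \<in> P" using convex_cellsD[OF convex_P rc(1,2), of "r + 1" c] cc lt by auto
      with nogap standard_onD[OF std] rc cc lt show False unfolding a_def b_def by (metis less_add_one)
    qed
    with cc show ?thesis by (simp add: content_def)
  qed
  moreover have "f i T = content (r', c') - content (r, c)"
    using inv cvec_entry[OF F rc(1)] cvec_entry[OF F rc(2)]
    by (auto simp: f_def simple_val_def a_def[symmetric] b_def[symmetric] add.commute[of "int i" 1] split: if_splits)
  ultimately show ?thesis by simp
qed

lemma f_sgen:
  assumes "filling P n T" "i < n" "j < n"
  shows "f i (sgen i \<circ> T) = - f i T"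
    "adjacent i j \<Longrightarrow> f j (sgen i \<circ> T) = f i T + f j T"
    "i \<noteq> j \<Longrightarrow> \<not> adjacent i j \<Longrightarrow> f j (sgen i \<circ> T) = f j T"
  using odd_cvec[OF assms(1)] simple_val_self simple_val_adjacent simple_val_commute
  by (auto simp: f_def cvec_sgen[OF assms(2) card2])

lemma g_sgen_self:
  assumes "filling P n T" "i < n"
  shows "g i (sgen i \<circ> T) = g i T"
  using f_sgen(1)[OF assms assms(2)] by (simp add: g_def)

lemma g_square:
  assumes "f i T \<noteq> 0"
  shows "(g i T)\<^sup>2 = 1 - 1 / (real_of_int (f i T))\<^sup>2"
proof -
  have "1 \<le> \<bar>real_of_int (f i T)\<bar>" using assms by linarith
  then have "1 \<le> (real_of_int (f i T))\<^sup>2" using one_le_power[of "\<bar>real_of_int (f i T)\<bar>" 2] by (simp only: power2_abs)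
  then have "1 / (real_of_int (f i T))\<^sup>2 \<le> 1" by (subst divide_le_eq_1) auto
  then show ?thesis by (simp add: g_def)
qed

text \<open>Where the neighbour \<open>T^s\<close> is missing from the basis, its coefficient is
  already 0; membership conditions thereby drop out of the coordinate formulas.\<close>

lemma g_zero_or_standard:
  assumes "T \<in> B" "i < n"
  shows "g i T = 0 \<or> sgen i \<circ> T \<in> B"
proof (cases "sgen i \<circ> T \<in> B")
  case False
  then have "f i T = 1 \<or> f i T = - 1" using f_eq_one_if_nonstandard[OF assms] by linarith
  then show ?thesis by (auto simp: g_def)
qed simp

section \<open>The Coxeter relations for the operators\<close>

abbreviation "R \<equiv> rhoop S m pos"

definition pr :: "(tab \<Rightarrow> real) \<Rightarrow> tab \<Rightarrow> real" where
  "pr v U = (if U \<in> B then v U else 0)"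

lemma sgen_comp_comp: "sgen i \<circ> (sgen i \<circ> T) = T"
  by (auto simp: fun_eq_iff)

text \<open>The matrix is symmetric, since \<open>s_i\<close> negates \<open>f_i\<close> and
  preserves \<open>g_i\<close>. Reading \<open>v\<close> outside the basis is harmless because the
  coefficient there is 0.\<close>

lemma R_eval:
  assumes "U \<in> B" "i < n"
  shows "R i v U = v U / f i U + g i U * v (sgen i \<circ> U)"
proof -
  have "R i v U = v U / f i U + (if sgen i \<circ> U \<in> B then g i (sgen i \<circ> U) * v (sgen i \<circ> U) else 0)"
    unfolding rhoop_def fD_eq_simple_val[OF assms(2) card2] f_def[symmetric] g_def
    by (rule matop_swap[OF finite_B assms(1)]) (rule sgen_comp_comp)
  then show ?thesis
    using g_sgen_self[OF B_filling[OF assms(1)] assms(2)] g_zero_or_standard[OF assms] by auto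
qed

lemma R_outside: "U \<notin> B \<Longrightarrow> R i v U = 0"
  by (simp add: rhoop_def matop_def)

lemma R_eval2:
  assumes "U \<in> B" "i < n" "j < n"
  shows "R i (R j v) U = (v U / f j U + g j U * v (sgen j \<circ> U)) / f i U +
    g i U * (v (sgen i \<circ> U) / f j (sgen i \<circ> U) + g j (sgen i \<circ> U) * v (sgen j \<circ> (sgen i \<circ> U)))"
proof (cases "sgen i \<circ> U \<in> B")
  case True
  show ?thesis
    unfolding R_eval[OF assms(1,2)] R_eval[OF assms(1,3)] R_eval[OF True assms(3)] ..
next
  case False
  then have "g i U = 0" using g_zero_or_standard[OF assms(1,2)] by simp
  then show ?thesis using R_eval assms by simp
qed

lemma R_square:
  assumes "i < n"
  shows "R i \<circ> R i = pr"
proof (intro ext)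
  fix v :: "tab \<Rightarrow> real" and U :: tab
  show "(R i \<circ> R i) v U = pr v U"
  proof (cases "U \<in> B")
    case True
    note F = B_filling[OF True]
    define a x where "a = real_of_int (f i U)" and "x = g i U"
    have a: "a \<noteq> 0" "x * x = 1 - 1 / a\<^sup>2"
      using f_nonzero[OF True assms] g_square[of i U] by (auto simp: a_def x_def power2_eq_square)
    have "R i (R i v) U = (v U / a + x * v (sgen i \<circ> U)) / a + x * (v (sgen i \<circ> U) / (- a) + x * v U)"
      unfolding R_eval2[OF True assms assms] f_sgen(1)[OF F assms assms] g_sgen_self[OF F assms]
        sgen_comp_comp by (simp add: a_def x_def)
    also have "\<dots> = v U * (1 / a\<^sup>2 + x * x)"
      using a(1) by (simp add: field_simps power2_eq_square)
    finally show ?thesis using True a by (simp add: pr_def)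
  qed (simp add: R_outside pr_def)
qed

lemma R_commute:
  assumes "i < n" "j < n" "i \<noteq> j" "\<not> adjacent i j"
  shows "R i \<circ> R j = R j \<circ> R i"
proof (intro ext)
  fix v :: "tab \<Rightarrow> real" and U :: tab
  have na: "\<not> adjacent j i" "j \<noteq> i" using assms by (auto simp: adjacent_def)
  have eq: "sgen j \<circ> (sgen i \<circ> U) = sgen i \<circ> (sgen j \<circ> U)"
    using sgen_commute[OF assms(3,4)] by (auto simp: fun_eq_iff)
  show "(R i \<circ> R j) v U = (R j \<circ> R i) v U"
  proof (cases "U \<in> B")
    case True
    note F = B_filling[OF True]
    have ff: "f j (sgen i \<circ> U) = f j U" "f i (sgen j \<circ> U) = f i U"
      using f_sgen(3)[OF F] assms na by auto
    then have gg: "g j (sgen i \<circ> U) = g j U" "g i (sgen j \<circ> U) = g i U" by (simp_all add: g_def)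
    show ?thesis
      unfolding comp_apply R_eval2[OF True assms(1,2)] R_eval2[OF True assms(2,1)] ff gg eq
      by (simp add: add_divide_distrib algebra_simps)
  qed (simp add: R_outside)
qed

text \<open>Shaped to match one side of \<open>braid_identity\<close>; the other side is this
  formula with \<open>i\<close> and \<open>j\<close> exchanged. The reflection formulas give the
  values \<open>-a\<close>, \<open>a + b\<close> and \<open>b\<close> along the word.\<close>

lemma R_eval3:
  assumes "U \<in> B" "i < n" "j < n" "adjacent i j"
  defines "a \<equiv> real_of_int (f i U)" and "b \<equiv> real_of_int (f j U)"
    and "x \<equiv> g i U" and "y \<equiv> g j U" and "z \<equiv> sqrt (1 - 1 / (real_of_int (f i U + f j U))\<^sup>2)"
  shows "R i (R j (R i v)) U =
    ((v U / a + x * v (sgen i \<circ> U)) / b + y * (v (sgen j \<circ> U) / (a + b) + z * v (sgen i \<circ> (sgen j \<circ> U)))) / a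
      + x * ((v (sgen i \<circ> U) / (- a) + x * v U) / (a + b)
        + z * (v (sgen j \<circ> (sgen i \<circ> U)) / b + y * v (sgen i \<circ> (sgen j \<circ> (sgen i \<circ> U)))))"
proof -
  note F = B_filling[OF assms(1)]
  have adj: "adjacent j i" using assms(4) by (auto simp: adjacent_def)
  have Fi: "filling P n (sgen i \<circ> U)" using filling_sgen[OF F assms(2)] .
  have ff: "f j (sgen i \<circ> U) = f i U + f j U" "f i (sgen j \<circ> U) = f i U + f j U" "f i (sgen i \<circ> U) = - f i U"
    using f_sgen(1,2)[OF F] assms(2-4) adj by (auto simp: add.commute)
  have ff2: "f i (sgen j \<circ> (sgen i \<circ> U)) = f j U"
    using f_sgen(2)[OF Fi assms(3,2) adj] ff by simp
  have gg: "g j (sgen i \<circ> U) = z" "g i (sgen j \<circ> U) = z" "g i (sgen i \<circ> U) = x"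
    "g i (sgen j \<circ> (sgen i \<circ> U)) = y"
    by (simp_all only: g_def z_def x_def y_def ff ff2) simp
  have ab: "real_of_int (f i U + f j U) = a + b" by (simp add: a_def b_def)
  have U: "R j (R i v) U = (v U / a + x * v (sgen i \<circ> U)) / b
      + y * (v (sgen j \<circ> U) / (a + b) + z * v (sgen i \<circ> (sgen j \<circ> U)))"
    unfolding R_eval2[OF assms(1,3,2)] ff gg ab by (simp add: a_def b_def x_def y_def)
  show ?thesis
  proof (cases "sgen i \<circ> U \<in> B")
    case True
    have "R j (R i v) (sgen i \<circ> U) = (v (sgen i \<circ> U) / (- a) + x * v U) / (a + b)
        + z * (v (sgen j \<circ> (sgen i \<circ> U)) / b + y * v (sgen i \<circ> (sgen j \<circ> (sgen i \<circ> U))))"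
      unfolding R_eval2[OF True assms(3,2)] ff ff2 gg ab sgen_comp_comp by (simp add: a_def b_def)
    then show ?thesis unfolding R_eval[OF assms(1,2)] U by (simp add: a_def x_def)
  next
    case False
    then have "x = 0" using g_zero_or_standard[OF assms(1,2)] by (simp add: x_def)
    then show ?thesis unfolding R_eval[OF assms(1,2)] U by (simp add: a_def x_def)
  qed
qed

lemma R_braid:
  assumes "i < n" "j < n" "adjacent i j"
  shows "R i \<circ> R j \<circ> R i = R j \<circ> R i \<circ> R j"
proof (intro ext)
  fix v :: "tab \<Rightarrow> real" and U :: tab
  have adj: "adjacent j i" using assms(3) by (auto simp: adjacent_def)
  have eq: "sgen i \<circ> (sgen j \<circ> (sgen i \<circ> U)) = sgen j \<circ> (sgen i \<circ> (sgen j \<circ> U))"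
    using sgen_braid[OF assms(3)] by (auto simp: fun_eq_iff)
  show "(R i \<circ> R j \<circ> R i) v U = (R j \<circ> R i \<circ> R j) v U"
  proof (cases "U \<in> B")
    case True
    have nz: "real_of_int (f i U) \<noteq> 0" "real_of_int (f j U) \<noteq> 0" "real_of_int (f i U) + real_of_int (f j U) \<noteq> 0"
      using f_nonzero[OF True] f_sum_nonzero[OF True assms] assms by (auto simp flip: of_int_add)
    have sq: "(g i U)\<^sup>2 = 1 - 1 / (real_of_int (f i U))\<^sup>2" "(g j U)\<^sup>2 = 1 - 1 / (real_of_int (f j U))\<^sup>2"
      using g_square nz by auto
    show ?thesis
      unfolding comp_apply R_eval3[OF True assms] R_eval3[OF True assms(2,1) adj] eq
      using braid_identity[OF refl nz sq] by (simp only: add.commute[of "f j U"] add.commute[of "real_of_int (f j U)"])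
  qed (simp add: R_outside)
qed

lemma R_pr:
  assumes "i < n"
  shows "R i \<circ> pr = R i"
proof (intro ext)
  fix v :: "tab \<Rightarrow> real" and U :: tab
  show "(R i \<circ> pr) v U = R i v U"
    by (simp add: rhoop_def matop_def pr_def cong: sum.cong)
qed

lemma pr_R: "pr \<circ> R i = R i"
  by (auto simp: fun_eq_iff pr_def R_outside)

sublocale Dn_operators n R pr
  using card2 R_square R_pr pr_R R_commute R_braid by unfold_locales auto

end

section \<open>The intertwiner\<close>

lemma matop_matop:
  assumes "finite B"
  shows "matop B M (matop B N v) = matop B (\<lambda>U T. \<Sum>W\<in>B. M U W * N W T) v"
proof
  fix U
  have "(\<Sum>W\<in>B. M U W * (\<Sum>T\<in>B. N W T * v T)) = (\<Sum>T\<in>B. (\<Sum>W\<in>B. M U W * N W T) * v T)"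
    unfolding sum_distrib_left sum_distrib_right by (subst sum.swap) (simp add: mult.assoc)
  then show "matop B M (matop B N v) U = matop B (\<lambda>U T. \<Sum>W\<in>B. M U W * N W T) v U"
    by (simp add: matop_def)
qed

context D_tableaux
begin

text \<open>The matrix form yields linearity and supplies the coefficients of the linear system in
  the proof of surjectivity.\<close>

lemma rep_matop:
  assumes "x \<in> Dn n"
  shows "\<exists>M. rep x = matop B M"
  using assms card2
proof (induction rule: Dn_generated_induct)
  case id
  have "pr = matop B (\<lambda>U T. if U = T then 1 else 0)"
    using finite_B by (intro ext) (simp add: pr_def matop_def if_distrib[of "\<lambda>c. c * _"] cong: if_cong)
  then show "\<exists>M. rep id = matop B M" using rep_id by auto
next
  case (step x i)
  obtain M where M: "rep x = matop B M" using step(3) by blast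
  obtain N where N: "R i = matop B N" by (auto simp: rhoop_def)
  have "rep (x \<circ> sgen i) = matop B (\<lambda>U T. \<Sum>W\<in>B. M U W * N W T)"
    unfolding rep_sgen_right[OF step(1,2)] M N by (auto simp: matop_matop[OF finite_B])
  then show "\<exists>M. rep (x \<circ> sgen i) = matop B M" by blast
qed

lemma rep_linear:
  assumes "x \<in> Dn n"
  shows "rep x (\<lambda>U. a * v U + b * w U) = (\<lambda>U. a * rep x v U + b * rep x w U)"
  using rep_matop[OF assms] matop_linear by metis

section \<open>The embedded copy of the Young representation\<close>

definition tab_of :: "tab \<Rightarrow> tab" where
  "tab_of Q = flip1 pos \<circ> Q \<circ> unshift"

text \<open>The counterpart of \<open>filling\<close>: a Young tableau without standardness, so that
  interchanging \<open>i\<close> and \<open>i+1\<close> stays inside the notion.\<close>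

definition numbering :: "tab \<Rightarrow> bool" where
  "numbering Q \<longleftrightarrow> (\<forall>c. c \<notin> S \<longrightarrow> Q c = 0) \<and> Q ` S = {1..int n}"

lemma SYT_iff: "Q \<in> SYT S \<longleftrightarrow> numbering Q \<and> standard_on S Q"
  by (auto simp: SYT_def numbering_def)

lemma numbering_bij: "numbering Q \<Longrightarrow> bij_betw Q S {1..int n}"
  using eq_card_imp_inj_on[OF finite_S, of Q] by (simp add: numbering_def bij_betw_def)

lemma numbering_nonneg: "numbering Q \<Longrightarrow> 0 \<le> Q c"
  unfolding numbering_def by (cases "c \<in> S") (force, metis order_refl)

lemma numbering_unshift_bij: "numbering Q \<Longrightarrow> bij_betw (\<lambda>c. Q (unshift c)) P {1..int n}"
  using bij_betw_trans[OF bij_unshift numbering_bij] by (simp add: comp_def)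

lemma numbering_pos: "numbering Q \<Longrightarrow> c \<in> P \<Longrightarrow> Q (unshift c) \<in> {1..int n}"
  using bij_betwE[OF numbering_unshift_bij, of Q] by blast

lemma flip_signed: "flip1 pos \<in> signed_perms n"
  using flip1_signed card2 by simp

lemma filling_tab_of:
  assumes "numbering Q"
  shows "filling P n (tab_of Q)"
proof -
  have "filling P n (\<lambda>c. Q (unshift c))"
    unfolding filling_def
  proof (intro conjI ballI allI impI)
    fix c
    show "Q (unshift c) = 0" if "c \<notin> P" using that assms unfolding place_iff numbering_def by blast
    show "Q (unshift c) \<noteq> 0" "\<bar>Q (unshift c)\<bar> \<le> int n" if "c \<in> P"
      using numbering_pos[OF assms that] by auto
  next
    show "inj_on (\<lambda>c. \<bar>Q (unshift c)\<bar>) P"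
      using numbering_unshift_bij[OF assms] numbering_nonneg[OF assms] by (simp add: bij_betw_def)
  qed
  from filling_comp[OF this flip_signed] show ?thesis by (simp add: tab_of_def comp_def)
qed

lemma standard_tab_of:
  assumes "numbering Q"
  shows "standard_on P (tab_of Q) \<longleftrightarrow> standard_on S Q"
proof -
  have less: "tab_of Q c < tab_of Q c' \<longleftrightarrow> Q (unshift c) < Q (unshift c')" if "c \<in> P" "c' \<in> P" for c c'
    using flip1_less_iff[of "Q (unshift c)" "Q (unshift c')" pos] numbering_pos[OF assms that(1)]
      numbering_pos[OF assms that(2)] by (simp add: tab_of_def)
  show ?thesis
  proof
    assume st: "standard_on P (tab_of Q)"
    show "standard_on S Q"
      unfolding standard_on_def
    proof (intro allI impI)
      fix i j i' j'
      assume h: "(i, j) \<in> S" "(i', j') \<in> S" "(i = i' \<and> j < j') \<or> (j = j' \<and> i < i')"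
      have p: "(i, j + offset) \<in> P" "(i', j' + offset) \<in> P" using h by (simp_all add: place_iff unshift_def)
      have "tab_of Q (i, j + offset) < tab_of Q (i', j' + offset)"
        by (rule standard_onD[OF st p]) (use h in auto)
      then show "Q (i, j) < Q (i', j')" unfolding less[OF p] by (simp add: unshift_def)
    qed
  next
    assume st: "standard_on S Q"
    show "standard_on P (tab_of Q)"
      unfolding standard_on_def
    proof (intro allI impI)
      fix i j i' j'
      assume h: "(i, j) \<in> P" "(i', j') \<in> P" "(i = i' \<and> j < j') \<or> (j = j' \<and> i < i')"
      have p: "(i, j - offset) \<in> S" "(i', j' - offset) \<in> S" using h by (simp_all add: place_iff unshift_def)
      have "Q (i, j - offset) < Q (i', j' - offset)"
        by (rule standard_onD[OF st p]) (use h in auto)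
      then show "tab_of Q (i, j) < tab_of Q (i', j')" unfolding less[OF h(1,2)] by (simp add: unshift_def)
    qed
  qed
qed

lemma tab_of_in_B_iff:
  assumes "numbering Q"
  shows "tab_of Q \<in> B \<longleftrightarrow> Q \<in> SYT S"
proof -
  have bij: "bij_betw (\<lambda>c. \<bar>Q (unshift c)\<bar>) P {1..int n}"
    using numbering_unshift_bij[OF assms] numbering_nonneg[OF assms] by simp
  have "(\<Prod>c\<in>P. sgn (Q (unshift c))) = 1"
    by (rule prod.neutral) (use numbering_pos[OF assms] in force)
  then have "(\<Prod>c\<in>P. sgn (tab_of Q c)) = sign_prod n (flip1 pos)"
    using prod_sgn_signed_perm[OF flip_signed bij] by (simp add: tab_of_def)
  then show ?thesis
    using filling_tab_of[OF assms] standard_tab_of[OF assms] assms by (simp add: B_iff SYT_iff)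
qed

lemma numbering_transp:
  assumes "numbering Q" "1 \<le> i" "i < n"
  shows "numbering (transp (int i) \<circ> Q)"
proof -
  have "transp (int i) ` {1..int n} = {1..int n}"
  proof
    show sub: "transp (int i) ` {1..int n} \<subseteq> {1..int n}" using assms by (auto simp: transp_def)
    show "{1..int n} \<subseteq> transp (int i) ` {1..int n}"
    proof
      fix k assume "k \<in> {1..int n}"
      then show "k \<in> transp (int i) ` {1..int n}"
        using sub by (intro image_eqI[of _ _ "transp (int i) k"]) (simp, blast)
    qed
  qed
  then have "(transp (int i) \<circ> Q) ` S = {1..int n}"
    using assms(1) unfolding numbering_def image_comp[symmetric] by simp
  then show ?thesis using assms by (simp add: numbering_def transp_def)
qed

lemma tab_of_transp:
  assumes "numbering Q" "1 \<le> i"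
  shows "tab_of (transp (int i) \<circ> Q) = sgen (gidx pos i) \<circ> tab_of Q"
  using sgen_gidx_flip1[OF assms(2) numbering_nonneg[OF assms(1)]] by (intro ext) (simp add: tab_of_def)

lemma cvec_tab_of:
  assumes "numbering Q" "k \<in> {1..int n}"
  shows "cvec P n (tab_of Q) (flip1 pos k) = cS S Q k + offset"
proof -
  obtain c where c: "c \<in> P" "Q (unshift c) = k"
    using bij_betw_imp_surj_on[OF numbering_unshift_bij[OF assms(1)]] assms(2) by (metis imageE)
  have "(THE c'. c' \<in> S \<and> Q c' = k) = unshift c"
  proof (rule the_equality)
    show "unshift c \<in> S \<and> Q (unshift c) = k" using c by (simp add: place_iff)
    then show "c' = unshift c" if "c' \<in> S \<and> Q c' = k" for c'
      using inj_onD[OF bij_betw_imp_inj_on[OF numbering_bij[OF assms(1)]], of c' "unshift c"] that by simp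
  qed
  then have "cS S Q k = content c - offset" by (simp add: cS_def content_unshift)
  moreover have "tab_of Q c = flip1 pos k" using c by (simp add: tab_of_def)
  ultimately show ?thesis using cvec_entry(1)[OF filling_tab_of[OF assms(1)] c(1)] by simp
qed

text \<open>Translation of the shape cancels in differences. In case (2) with \<open>i = 1\<close>,
  the cell numbered 1 holds \<open>-1\<close>, so \<open>c_1\<close> is minus its content and the
  sum \<open>f_0 = c_1 + c_2\<close> is again Young's difference.\<close>

lemma f_tab_of:
  assumes "numbering Q" "1 \<le> i" "i < n"
  shows "f (gidx pos i) (tab_of Q) = cS S Q (int i + 1) - cS S Q (int i)"
proof -
  have odd: "cvec P n (tab_of Q) (- 1) = - cvec P n (tab_of Q) 1"
    using odd_cvec[OF filling_tab_of[OF assms(1)]] by (simp add: odd_fun_def)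
  have "cvec P n (tab_of Q) (flip1 pos (int i)) = cS S Q (int i) + offset"
    "cvec P n (tab_of Q) (flip1 pos (int i + 1)) = cS S Q (int i + 1) + offset"
    using cvec_tab_of[OF assms(1)] assms by auto
  then show ?thesis
    using odd assms(2) by (auto simp: f_def simple_val_def gidx_def flip1_def split: if_splits)
qed

lemma gidx_less: "i < n \<Longrightarrow> gidx pos i < n"
  by (auto simp: gidx_def)

text \<open>Row \<open>tab_of Q\<close> of the operator involves only \<open>tab_of Q\<close> and
  its neighbour, which lies in the copy or has coefficient 0. Hence restricting coordinates to the
  copy commutes with the subgroup generators, as the induced space requires of
  \<open>Phi\<close>.\<close>

lemma youngop_tab_of:
  assumes "Q \<in> SYT S" "1 \<le> i" "i < n"
  shows "youngop S i (\<lambda>Q'. if Q' \<in> SYT S then u (tab_of Q') else 0) Q = R (gidx pos i) u (tab_of Q)"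
proof -
  let ?j = "gidx pos i" and ?Q' = "transp (int i) \<circ> Q"
  have num: "numbering Q" using assms(1) by (simp add: SYT_iff)
  have num': "numbering ?Q'" using numbering_transp[OF num assms(2,3)] .
  have inB: "tab_of Q \<in> B" using tab_of_in_B_iff[OF num] assms(1) by simp
  have fin: "finite (SYT S)"
  proof (rule finite_imageD[of tab_of])
    show "finite (tab_of ` SYT S)"
      by (rule finite_subset[OF _ finite_B]) (auto simp: tab_of_in_B_iff SYT_iff)
    show "inj_on tab_of (SYT S)"
    proof (rule inj_onI)
      fix Q1 Q2 assume "tab_of Q1 = tab_of Q2"
      then have "flip1 pos (tab_of Q1 (i, j + offset)) = flip1 pos (tab_of Q2 (i, j + offset))" for i j by simp
      then show "Q1 = Q2" by (auto simp: fun_eq_iff tab_of_def unshift_def)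
    qed
  qed
  have iff: "?Q' \<in> SYT S \<longleftrightarrow> sgen ?j \<circ> tab_of Q \<in> B"
    using tab_of_in_B_iff[OF num'] tab_of_transp[OF num assms(2)] by simp
  have h': "cS S ?Q' (int i + 1) - cS S ?Q' (int i) = - f ?j (tab_of Q)"
    using f_tab_of[OF num' assms(2,3)] tab_of_transp[OF num assms(2)]
      f_sgen(1)[OF B_filling[OF inB] gidx_less[OF assms(3)] gidx_less[OF assms(3)]] by simp
  have "youngop S i v Q = v Q / real_of_int (cS S Q (int i + 1) - cS S Q (int i)) +
     (if ?Q' \<in> SYT S then sqrt (1 - 1 / (real_of_int (cS S ?Q' (int i + 1) - cS S ?Q' (int i)))\<^sup>2) * v ?Q' else 0)" for v
    unfolding youngop_def
    by (rule matop_swap[OF fin assms(1), where F = "\<lambda>Q. real_of_int (cS S Q (int i + 1) - cS S Q (int i))"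
          and s = "\<lambda>Q. transp (int i) \<circ> Q"]) (auto simp: fun_eq_iff)
  then show ?thesis
    unfolding R_eval[OF inB gidx_less[OF assms(3)]] h' f_tab_of[OF num assms(2,3), symmetric]
    using g_zero_or_standard[OF inB gidx_less[OF assms(3)]] iff assms(1)
    by (auto simp: g_def tab_of_transp[OF num assms(2)])
qed

section \<open>The map into the induced space and its injectivity\<close>

abbreviation "gens \<equiv> {(sgen (gidx pos i), youngop S i) | i. 1 \<le> i \<and> i < n}"

abbreviation "W \<equiv> IndV n (SYT S) gens"

definition Phi :: "(tab \<Rightarrow> real) \<Rightarrow> (int \<Rightarrow> int) \<Rightarrow> tab \<Rightarrow> real" where
  "Phi v x Q = (if x \<in> Dn n \<and> Q \<in> SYT S then rep x v (tab_of Q) else 0)"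

lemma rep_sgen_left:
  assumes "x \<in> Dn n" "i < n"
  shows "rep (sgen i \<circ> x) = R i \<circ> rep x"
  using rep_comp[OF assms(1) sgen_Dn[OF assms(2) card2]] rep_sgen[OF assms(2)] by simp

lemma Phi_in_W: "Phi v \<in> W"
  unfolding IndV_def
proof (intro CollectI conjI allI impI ballI)
  fix x assume "x \<notin> Dn n"
  then show "Phi v x = (\<lambda>_. 0)" by (auto simp: Phi_def)
next
  fix x assume "x \<in> Dn n"
  then show "Phi v x \<in> Vsp (SYT S)" by (auto simp: Phi_def Vsp_def)
next
  fix hA assume "hA \<in> gens"
  then obtain i where i: "hA = (sgen (gidx pos i), youngop S i)" "1 \<le> i" "i < n" by blast
  have "Phi v (sgen (gidx pos i) \<circ> x) = youngop S i (Phi v x)" if x: "x \<in> Dn n" for x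
  proof
    fix Q
    have hx: "sgen (gidx pos i) \<circ> x \<in> Dn n"
      using Dn_comp[OF sgen_Dn[OF gidx_less[OF i(3)] card2] x] .
    have eq: "Phi v x = (\<lambda>Q. if Q \<in> SYT S then rep x v (tab_of Q) else 0)" using x by (auto simp: Phi_def)
    show "Phi v (sgen (gidx pos i) \<circ> x) Q = youngop S i (Phi v x) Q"
    proof (cases "Q \<in> SYT S")
      case True
      then show ?thesis
        unfolding eq youngop_tab_of[OF True i(2,3)]
        using hx rep_sgen_left[OF x gidx_less[OF i(3)]] by (simp add: Phi_def)
    next
      case False
      then show ?thesis by (simp add: Phi_def youngop_def matop_def)
    qed
  qed
  then show "case hA of (h, A) \<Rightarrow> \<forall>x\<in>Dn n. Phi v (h \<circ> x) = A (Phi v x)" using i by simp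
qed

lemma Phi_linear: "Phi (\<lambda>U. a * v U + b * w U) = (\<lambda>x Q. a * Phi v x Q + b * Phi w x Q)"
  by (auto simp: Phi_def fun_eq_iff rep_linear)

lemma Phi_intertwines:
  assumes "i < n"
  shows "Phi (R i v) = indact (sgen i) (Phi v)"
  using rep_sgen_right[OF _ assms] by (auto simp: Phi_def indact_def fun_eq_iff Dn_comp_sgen_iff[OF assms card2])

lemma large_f:
  assumes "T \<in> B" "i < n" "2 \<le> \<bar>f i T\<bar>"
  shows "sgen i \<circ> T \<in> B" "g i T \<noteq> 0"
proof -
  show "sgen i \<circ> T \<in> B" using f_eq_one_if_nonstandard[OF assms(1,2)] assms(3) by force
  have "1 < \<bar>real_of_int (f i T)\<bar>" using assms(3) by linarith
  then have "(real_of_int (f i T))\<^sup>2 \<noteq> 1" by (simp add: power2_eq_1_iff) linarith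
  then show "g i T \<noteq> 0" by (auto simp: g_def)
qed

text \<open>The sum of entries serves as potential: \<open>s_0\<close> turns \<open>-1, -2\<close>
  into \<open>2, 1\<close>, and \<open>s_i\<close> turns \<open>i, -(i+1)\<close> into
  \<open>i+1, -i\<close>; both raise it. If neither pair occurs, no \<open>-k\<close> with
  \<open>k \<ge> 2\<close> is left, and the parity fixes the sign of the entry of absolute value 1,
  so the tableau lies in the copy.\<close>

lemma closer_neighbour:
  assumes T: "T \<in> B" "T \<notin> tab_of ` SYT S"
  shows "\<exists>i<n. sgen i \<circ> T \<in> B \<and> g i T \<noteq> 0 \<and> (\<Sum>c\<in>P. T c) < (\<Sum>c\<in>P. (sgen i \<circ> T) c)"
proof -
  note F = B_filling[OF T(1)]
  have inj: "x = y" if "x \<in> P" "y \<in> P" "\<bar>T x\<bar> = \<bar>T y\<bar>" for x y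
    using F that by (auto simp: filling_def inj_on_def)
  have nz: "T x \<noteq> 0" "\<bar>T x\<bar> \<le> int n" if "x \<in> P" for x using F that by (auto simp: filling_def)
  consider (both) p q where "p \<in> P" "q \<in> P" "T p = -1" "T q = -2"
    | (gap) p q i where "p \<in> P" "q \<in> P" "1 \<le> i" "i < n" "T p = int i" "T q = - int i - 1"
    | (base) "\<not> (\<exists>p\<in>P. \<exists>q\<in>P. T p = -1 \<and> T q = -2)"
      "\<not> (\<exists>p\<in>P. \<exists>q\<in>P. \<exists>i. 1 \<le> i \<and> i < n \<and> T p = int i \<and> T q = - int i - 1)" by blast
  then show ?thesis
  proof cases
    case both
    have "f 0 T = - content p - content q"
      using cvec_entry(2)[OF F both(1)] cvec_entry(2)[OF F both(2)] both by (simp add: f_def simple_val_def)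
    then have "2 \<le> \<bar>f 0 T\<bar>" using content_P_pos[OF both(1)] content_P_pos[OF both(2)] by linarith
    note l = large_f[OF T(1) _ this]
    have "T c \<noteq> 1" "T c \<noteq> 2" if "c \<in> P" for c
      using inj[OF that both(1)] inj[OF that both(2)] both by auto
    then have "T c \<le> sgen 0 (T c)" if "c \<in> P" for c
      using that by (simp add: sgen_def)
    moreover have "T p < sgen 0 (T p)" using both by (simp add: sgen_def)
    ultimately have "(\<Sum>c\<in>P. T c) < (\<Sum>c\<in>P. (sgen 0 \<circ> T) c)"
      using both(1) by (intro sum_strict_mono_ex1[OF finite_P]) auto
    then show ?thesis using l card2 by (intro exI[of _ 0]) auto
  next
    case gap
    have "f i T = - content q - content p"
      using cvec_entry(1)[OF F gap(1)] cvec_entry(2)[OF F gap(2)] gap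
      by (simp add: f_def simple_val_def add.commute[of "int i" 1])
    then have "2 \<le> \<bar>f i T\<bar>" using content_P_pos[OF gap(1)] content_P_pos[OF gap(2)] by linarith
    note l = large_f[OF T(1) gap(4) this]
    have "T c \<noteq> int i + 1" "T c \<noteq> - int i" if "c \<in> P" for c
      using inj[OF that gap(1)] inj[OF that gap(2)] gap by auto
    then have "T c \<le> sgen i (T c)" if "c \<in> P" for c
      using that gap(3) by (simp add: sgen_def Let_def)
    moreover have "T p < sgen i (T p)" using gap by (simp add: sgen_def)
    ultimately have "(\<Sum>c\<in>P. T c) < (\<Sum>c\<in>P. (sgen i \<circ> T) c)"
      using gap(1) by (intro sum_strict_mono_ex1[OF finite_P]) auto
    then show ?thesis using l gap by blast
  next
    case base
    have no_gap: False if "p \<in> P" "q \<in> P" "1 \<le> i" "i < n" "T p = int i" "T q = - int i - 1" for p q i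
      using base(2) that by blast
    have no_both: False if "p \<in> P" "q \<in> P" "T p = -1" "T q = -2" for p q
      using base(1) that by blast
    \<comment> \<open>An entry \<open>-2\<close> would meet \<open>1\<close> or \<open>-1\<close>,
      and \<open>-(k+1)\<close> would meet \<open>k\<close>, because \<open>-k\<close> is already
      excluded; each is one of the forbidden pairs.\<close>
    have down: "\<not> (\<exists>q\<in>P. T q = - int k)" if "2 \<le> k" "k \<le> n" for k
      using that
    proof (induction k rule: dec_induct)
      case base
      show ?case
      proof
        assume "\<exists>q\<in>P. T q = - int 2"
        then obtain q where q: "q \<in> P" "T q = -2" by auto
        obtain p where p: "p \<in> P" "T p = 1 \<or> T p = - 1"
          using filling_cell[OF F finite_P card_P, of 1] card2 by (auto simp: signed_set_iff)
        show False
        proof (cases "T p = 1")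
          case True
          then show False using no_gap[OF p(1) q(1), of 1] q card2 by simp
        next
          case False
          then show False using no_both p q by blast
        qed
      qed
    next
      case (step k)
      show ?case
      proof
        assume "\<exists>q\<in>P. T q = - int (Suc k)"
        then obtain q where q: "q \<in> P" "T q = - int k - 1" by auto
        obtain p where p: "p \<in> P" "T p = int k \<or> T p = - int k"
          using filling_cell[OF F finite_P card_P, of "int k"] step by (auto simp: signed_set_iff)
        then have "T p = int k" using step by auto
        with step show False using no_gap[OF p(1) q(1), of k] q by simp
      qed
    qed
    have big: "0 < T c" if "c \<in> P" "\<bar>T c\<bar> \<noteq> 1" for c
    proof (rule ccontr)
      assume "\<not> 0 < T c"
      with that nz[OF that(1)] have "T c = - int (nat (- T c))" "2 \<le> nat (- T c)" "nat (- T c) \<le> n" by auto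
      with down that(1) show False by blast
    qed
    obtain p where p: "p \<in> P" "T p = 1 \<or> T p = - 1"
      using filling_cell[OF F finite_P card_P, of 1] card2 by (auto simp: signed_set_iff)
    have "(\<Prod>c\<in>P - {p}. sgn (T c)) = 1"
    proof (rule prod.neutral, rule ballI)
      fix c assume c: "c \<in> P - {p}"
      then have "\<bar>T c\<bar> \<noteq> 1" using inj[of c p] p by auto
      then show "sgn (T c) = 1" using big c by simp
    qed
    then have "(\<Prod>c\<in>P. sgn (T c)) = sgn (T p)" using prod.remove[OF finite_P p(1), of "\<lambda>c. sgn (T c)"] by simp
    then have Tp: "T p = (if pos then 1 else - 1)"
      using T(1) sign_prod_flip1[of n pos] card2 p by (auto simp: B_iff split: if_splits)
    have flip: "flip1 pos (T c) = \<bar>T c\<bar>" if "c \<in> P" for c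
    proof (cases "\<bar>T c\<bar> = 1")
      case True
      then have "c = p" using inj[OF that p(1)] p by auto
      then show ?thesis using Tp by (simp add: flip1_def)
    next
      case False
      then show ?thesis using big[OF that] by (simp add: flip1_def)
    qed
    define shift where "shift = (\<lambda>c :: cell. (fst c, snd c + offset))"
    have sh: "unshift (shift c) = c" "shift (unshift c) = c" for c
      by (auto simp: shift_def unshift_def)
    define Q where "Q = flip1 pos \<circ> T \<circ> shift"
    have TQ: "tab_of Q = T" by (auto simp: tab_of_def Q_def sh)
    have "numbering Q"
      unfolding numbering_def
    proof
      show "\<forall>c. c \<notin> S \<longrightarrow> Q c = 0"
      proof (intro allI impI)
        fix c assume "c \<notin> S"
        then have "shift c \<notin> P" by (simp add: place_iff sh)
        then have "T (shift c) = 0" using F unfolding filling_def by blast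
        then show "Q c = 0" by (simp add: Q_def)
      qed
      have "Q ` S = (\<lambda>c. \<bar>T c\<bar>) ` P"
      proof
        show "Q ` S \<subseteq> (\<lambda>c. \<bar>T c\<bar>) ` P"
          using flip by (auto simp: Q_def place_iff sh intro!: image_eqI[of _ _ "shift _"])
        show "(\<lambda>c. \<bar>T c\<bar>) ` P \<subseteq> Q ` S"
          using flip by (auto simp: Q_def place_iff sh intro!: image_eqI[of _ _ "unshift _"])
      qed
      then show "Q ` S = {1..int n}"
        using filling_abs_bij[OF F finite_P card_P] by (simp add: bij_betw_def)
    qed
    then have "Q \<in> SYT S" using tab_of_in_B_iff TQ T(1) by metis
    with TQ T(2) show ?thesis by blast
  qed
qed

text \<open>Induction on the potential for all \<open>x\<close> at once. The coordinate of
  \<open>rep (s_i x) v\<close> at \<open>T^s\<close> combines those of \<open>rep x v\<close> at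
  \<open>T^s\<close> and at \<open>T\<close>. Both coordinates at \<open>T^s\<close> vanish by
  induction, and the coefficient of the one at \<open>T\<close> is nonzero.\<close>

lemma Phi_zero_imp:
  assumes "Phi v = (\<lambda>x Q. 0)" "T \<in> B" "x \<in> Dn n"
  shows "rep x v T = 0"
  using assms(2,3)
proof (induction "nat (int n * int n - (\<Sum>c\<in>P. T c))" arbitrary: T x rule: less_induct)
  case less
  show ?case
  proof (cases "T \<in> tab_of ` SYT S")
    case True
    then obtain Q where "Q \<in> SYT S" "T = tab_of Q" by blast
    then show ?thesis using fun_cong[OF fun_cong[OF assms(1), of x], of Q] less.prems by (simp add: Phi_def)
  next
    case False
    obtain i where i: "i < n" "sgen i \<circ> T \<in> B" "g i T \<noteq> 0" "(\<Sum>c\<in>P. T c) < (\<Sum>c\<in>P. (sgen i \<circ> T) c)"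
      using closer_neighbour[OF less.prems(1) False] by blast
    have "(sgen i \<circ> T) c \<le> int n" if "c \<in> P" for c
      using B_filling[OF i(2)] that by (auto simp: filling_def)
    then have "(\<Sum>c\<in>P. (sgen i \<circ> T) c) \<le> int n * int n"
      using sum_bounded_above[of P "sgen i \<circ> T" "int n"] card_P by simp
    then have IH: "rep y v (sgen i \<circ> T) = 0" if "y \<in> Dn n" for y
      using less.hyps[OF _ i(2) that] i(4) by auto
    have "rep (sgen i \<circ> x) v (sgen i \<circ> T) = R i (rep x v) (sgen i \<circ> T)"
      using rep_sgen_left[OF less.prems(2) i(1)] by simp
    also have "\<dots> = g i T * rep x v T"
      unfolding R_eval[OF i(2,1)] g_sgen_self[OF B_filling[OF less.prems(1)] i(1)] sgen_comp_comp
      using IH[OF less.prems(2)] by simp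
    finally show ?thesis
      using IH[OF Dn_comp[OF sgen_Dn[OF i(1) card2] less.prems(2)]] i(3) by simp
  qed
qed

lemma Phi_kernel:
  assumes "v \<in> Vsp B" "Phi v = (\<lambda>x Q. 0)"
  shows "v = (\<lambda>U. 0)"
proof
  fix U
  show "v U = 0"
    using Phi_zero_imp[OF assms(2) _ Dn_id, of U] assms(1) by (cases "U \<in> B") (auto simp: rep_id pr_def Vsp_def)
qed

section \<open>Coset representatives and surjectivity\<close>

definition Y :: "(int \<Rightarrow> int) set" where
  "Y = {y \<in> Dn n. strict_mono_on {1..int n} (y \<circ> flip1 pos)}"

lemma sgen_flip_comp: "1 \<le> i \<Longrightarrow> sgen (gidx pos i) \<circ> flip1 pos = flip1 pos \<circ> sgen i"
  using sgen_gidx_flip1_signed by auto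

text \<open>Every coset of the inducing subgroup is represented by the inverse of some \<open>y \<in> Y\<close>,
  found by sorting \<open>y(1),\<dots>,y(n)\<close> (with the sign of the first entry flipped in case (2)).\<close>

lemma W_determined:
  assumes F: "F \<in> W" "F' \<in> W" and agree: "\<And>y Q. y \<in> Y \<Longrightarrow> Q \<in> SYT S \<Longrightarrow> F (inv y) Q = F' (inv y) Q"
  shows "F = F'"
proof -
  have Vsp: "F x \<in> Vsp (SYT S)" "F' x \<in> Vsp (SYT S)" if "x \<in> Dn n" for x
    using F that by (auto simp: IndV_def)
  have equiv: "G (sgen (gidx pos i) \<circ> x) = youngop S i (G x)"
    if "G \<in> W" "1 \<le> i" "i < n" "x \<in> Dn n" for G i x
    using that unfolding IndV_def by blast
  \<comment> \<open>The measure is taken at \<open>z \<circ> flip1 pos\<close>, the map to be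
    sorted. Multiplying it by \<open>s_i\<close> on the right multiplies \<open>z\<close> by a
    subgroup generator on the right and \<open>inv z\<close> on the left, where equivariance
    applies.\<close>
  have main: "F (inv z) = F' (inv z)" if "z \<in> Dn n" for z
    using that
  proof (induction "nat (int n * int n * int n - pairing n (z \<circ> flip1 pos))" arbitrary: z rule: less_induct)
    case less
    have sp: "z \<circ> flip1 pos \<in> signed_perms n"
      using signed_perms_comp[OF Dn_signed[OF less.prems] flip_signed] .
    show ?case
    proof (cases "z \<in> Y")
      case True
      show ?thesis
      proof
        fix Q
        show "F (inv z) Q = F' (inv z) Q"
          using agree[OF True, of Q] Vsp[OF Dn_inv[OF less.prems]]
          by (cases "Q \<in> SYT S") (auto simp: Vsp_def)
      qed
    next
      case False
      then have "\<not> strict_mono_on {1..int n} (z \<circ> flip1 pos)" using less.prems by (simp add: Y_def)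
      then obtain k where k: "1 \<le> k" "k < int n" "\<not> (z \<circ> flip1 pos) k < (z \<circ> flip1 pos) (k + 1)"
        using strict_mono_on_stepI[of "int n" "z \<circ> flip1 pos"] by blast
      define i where "i = nat k"
      have i: "1 \<le> i" "i < n" "simple_val (z \<circ> flip1 pos) i \<le> 0"
        using k by (auto simp: i_def simple_val_def)
      then have neg: "simple_val (z \<circ> flip1 pos) i < 0"
        using simple_val_nonzero[OF sp card2, of i] by linarith
      let ?h = "sgen (gidx pos i)"
      define z' where "z' = z \<circ> ?h"
      have h: "?h \<in> Dn n" using sgen_Dn[OF gidx_less[OF i(2)] card2] .
      have z': "z' \<in> Dn n" using Dn_comp[OF less.prems h] by (simp add: z'_def)
      have "z' \<circ> flip1 pos = z \<circ> flip1 pos \<circ> sgen i"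
        using sgen_flip_comp[OF i(1)] by (simp add: z'_def comp_assoc)
      then have "pairing n (z \<circ> flip1 pos) < pairing n (z' \<circ> flip1 pos)"
        using pairing_sgen[OF i(2) card2 odd_fun_signed_perms[OF sp]] neg i(1) by auto
      moreover have "pairing n (z' \<circ> flip1 pos) \<le> int n * int n * int n"
        by (rule pairing_le) (rule signed_perms_comp[OF Dn_signed[OF z'] flip_signed])
      ultimately have IH: "F (inv z') = F' (inv z')" using less.hyps[OF _ z'] by auto
      have "inv z' = inv ?h \<circ> inv z"
        unfolding z'_def using bij_signed_perms[OF Dn_signed[OF h]] bij_signed_perms[OF Dn_signed[OF less.prems]]
        by (simp add: o_inv_distrib)
      moreover have "inv ?h = ?h" using inv_unique_comp[OF sgen_o_sgen sgen_o_sgen] .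
      ultimately have inv: "inv z = ?h \<circ> inv z'" by (simp add: comp_assoc[symmetric] sgen_o_sgen)
      show ?thesis
        unfolding inv equiv[OF F(1) i(1,2) Dn_inv[OF z']] equiv[OF F(2) i(1,2) Dn_inv[OF z']] IH ..
    qed
  qed
  show ?thesis
  proof
    fix x
    show "F x = F' x"
    proof (cases "x \<in> Dn n")
      case True
      then show ?thesis using main[OF Dn_inv[OF True]] bij_signed_perms[OF Dn_signed[OF True]] by (simp add: inv_inv_eq)
    next
      case False
      then show ?thesis using F by (simp add: IndV_def)
    qed
  qed
qed

text \<open>The entries of \<open>tab_of Q\<close> are the flipped values of \<open>1..n\<close>, on
  which an element of \<open>Y\<close> is increasing.\<close>

lemma Y_tab_of_in_B:
  assumes "y \<in> Y" "Q \<in> SYT S"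
  shows "y \<circ> tab_of Q \<in> B"
proof (rule comp_Dn_in_B)
  have num: "numbering Q" using assms by (simp add: SYT_iff)
  show TB: "tab_of Q \<in> B" using assms tab_of_in_B_iff[OF num] by simp
  show "y \<in> Dn n" using assms by (simp add: Y_def)
  have mono: "strict_mono_on {1..int n} (y \<circ> flip1 pos)" using assms by (simp add: Y_def)
  show "standard_on P (y \<circ> tab_of Q)"
    unfolding standard_on_def
  proof (intro allI impI)
    fix i j i' j'
    assume h: "(i, j) \<in> P" "(i', j') \<in> P" "(i = i' \<and> j < j') \<or> (j = j' \<and> i < i')"
    have "tab_of Q (i, j) < tab_of Q (i', j')" using TB standard_onD h by (metis B_iff)
    moreover have r: "Q (unshift (i, j)) \<in> {1..int n}" "Q (unshift (i', j')) \<in> {1..int n}"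
      using numbering_pos[OF num] h by auto
    ultimately have "Q (unshift (i, j)) < Q (unshift (i', j'))"
      using flip1_less_iff[of "Q (unshift (i, j))" "Q (unshift (i', j'))" pos] by (simp add: tab_of_def)
    then show "(y \<circ> tab_of Q) (i, j) < (y \<circ> tab_of Q) (i', j')"
      using strict_mono_onD[OF mono r] by (simp add: tab_of_def)
  qed
qed

text \<open>The set of entries of \<open>y \<circ> tab_of Q\<close> is the image of
  \<open>1..n\<close> under an increasing map and so determines that map, hence \<open>y\<close>;
  cancelling \<open>y\<close> recovers \<open>Q\<close>.\<close>

lemma Y_tab_of_inj: "inj_on (\<lambda>(y, Q). y \<circ> tab_of Q) (Y \<times> SYT S)"
proof (rule inj_onI, clarify)
  fix y Q y' Q'
  assume h: "y \<in> Y" "Q \<in> SYT S" "y' \<in> Y" "Q' \<in> SYT S" and eq: "y \<circ> tab_of Q = y' \<circ> tab_of Q'"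
  have num: "numbering Q" "numbering Q'" using h by (auto simp: SYT_iff)
  have img: "(a \<circ> tab_of q) ` P = (a \<circ> flip1 pos) ` {1..int n}" if "numbering q" for a q
  proof -
    have "(\<lambda>c. q (unshift c)) ` P = {1..int n}"
      using numbering_unshift_bij[OF that] by (simp add: bij_betw_def)
    then have "(a \<circ> flip1 pos) ` {1..int n} = (a \<circ> flip1 pos) ` (\<lambda>c. q (unshift c)) ` P" by simp
    then show ?thesis unfolding image_image by (simp add: tab_of_def)
  qed
  have yD: "y \<in> signed_perms n" "y' \<in> signed_perms n" using h by (auto simp: Y_def Dn_iff)
  have pos_eq: "y (flip1 pos k) = y' (flip1 pos k)" if "k \<in> {1..int n}" for k
    using strict_mono_same_image_eq[of "int n" "y \<circ> flip1 pos" "y' \<circ> flip1 pos" k] h that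
      img[OF num(1), of y] img[OF num(2), of y'] eq by (simp add: Y_def)
  have "y (flip1 pos k) = y' (flip1 pos k)" for k
  proof (cases "k \<in> signed_set n")
    case True
    then have "k \<in> {1..int n} \<or> - k \<in> {1..int n}" by (auto simp: signed_set_iff)
    then show ?thesis
      using pos_eq[of k] pos_eq[of "- k"] signed_perms_odd[OF yD(1)] signed_perms_odd[OF yD(2)]
        signed_perms_odd[OF flip_signed] by auto
  next
    case False
    then have "flip1 pos k \<notin> signed_set n" using signed_perms_mem_iff[OF flip_signed] by simp
    then show ?thesis using yD by (simp add: signed_perms_def)
  qed
  from this[of "flip1 pos _"] have yy: "y = y'" by auto
  have "inj y" using bij_signed_perms[OF yD(1)] by (simp add: bij_is_inj)
  with eq yy have "tab_of Q = tab_of Q'" by (metis fun.inj_map_strong inj_def fun_eq_iff comp_apply)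
  then have "flip1 pos (tab_of Q (i, j + offset)) = flip1 pos (tab_of Q' (i, j + offset))" for i j by simp
  then have "Q = Q'" by (auto simp: fun_eq_iff tab_of_def unshift_def)
  with yy show "y = y' \<and> Q = Q'" by simp
qed

text \<open>The unknowns are the coordinates of \<open>v\<close> and a scalar \<open>w None\<close>;
  the equations ask for \<open>Phi v = w None * F\<close> at the representatives. The extra scalar
  makes the unknowns outnumber the equations. In a nontrivial solution it cannot be 0, by
  injectivity, and dividing by it gives a preimage.\<close>

lemma Phi_surj:
  assumes "F \<in> W"
  shows "\<exists>v\<in>Vsp B. Phi v = F"
proof -
  let ?E = "Y \<times> SYT S" and ?A = "insert None (Some ` B)"
  have sub: "(\<lambda>(y, Q). y \<circ> tab_of Q) ` ?E \<subseteq> B" using Y_tab_of_in_B by auto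
  have finE: "finite ?E" using finite_imageD[OF finite_subset[OF sub finite_B] Y_tab_of_inj] .
  have "card ?E \<le> card B" using card_inj_on_le[OF Y_tab_of_inj sub finite_B] .
  also have "\<dots> < card ?A" using finite_B by (simp add: card_image)
  finally have less: "card ?E < card ?A" .
  obtain M where M: "\<And>x. x \<in> Dn n \<Longrightarrow> rep x = matop B (M x)" using rep_matop by metis
  define a where "a e t = (case t of None \<Rightarrow> - F (inv (fst e)) (snd e)
      | Some T \<Rightarrow> M (inv (fst e)) (tab_of (snd e)) T)" for e t
  obtain w where w: "\<exists>t\<in>?A. w t \<noteq> 0" "\<forall>e\<in>?E. (\<Sum>t\<in>?A. a e t * w t) = 0"
    using homogeneous_system_solution[OF finE _ less, of a] finite_B by blast
  define v where "v = (\<lambda>T. if T \<in> B then w (Some T) else 0)"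
  have v: "v \<in> Vsp B" by (simp add: v_def Vsp_def)
  have key: "Phi v (inv y) Q = w None * F (inv y) Q" if "y \<in> Y" "Q \<in> SYT S" for y Q
  proof -
    have inv: "inv y \<in> Dn n" using that Dn_inv by (simp add: Y_def)
    have TB: "tab_of Q \<in> B" using that tab_of_in_B_iff by (simp add: SYT_iff)
    have "(\<Sum>t\<in>?A. a (y, Q) t * w t) = 0" using w(2) that by blast
    moreover have "(\<Sum>t\<in>?A. a (y, Q) t * w t) = - F (inv y) Q * w None + (\<Sum>T\<in>B. M (inv y) (tab_of Q) T * v T)"
      using finite_B by (simp add: sum.reindex a_def v_def)
    ultimately show ?thesis using that inv TB by (simp add: Phi_def M matop_def)
  qed
  show ?thesis
  proof (cases "w None = 0")
    case True
    have "Phi v = Phi (\<lambda>U. 0)"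
    proof (rule W_determined[OF Phi_in_W Phi_in_W])
      fix y Q assume "y \<in> Y" "Q \<in> SYT S"
      then show "Phi v (inv y) Q = Phi (\<lambda>U. 0) (inv y) Q"
        using key True Phi_linear[of 0 v 0 v] by (simp add: fun_eq_iff)
    qed
    also have "\<dots> = (\<lambda>x Q. 0)" using Phi_linear[of 0 v 0 v] by simp
    finally have "v = (\<lambda>U. 0)" using Phi_kernel[OF v] by blast
    then have "w (Some T) = 0" if "T \<in> B" for T using that by (simp add: v_def fun_eq_iff) metis
    with True w(1) show ?thesis by auto
  next
    case False
    \<comment> \<open>The summand \<open>0 * v T\<close> only brings \<open>u\<close> into the shape
      of \<open>Phi_linear\<close>.\<close>
    define u where "u = (\<lambda>T. (1 / w None) * v T + 0 * v T)"
    have "u \<in> Vsp B" using v by (simp add: u_def Vsp_def)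
    moreover have "Phi u = F"
    proof (rule W_determined[OF Phi_in_W assms])
      fix y Q assume "y \<in> Y" "Q \<in> SYT S"
      then show "Phi u (inv y) Q = F (inv y) Q"
        using key False unfolding u_def Phi_linear by simp
    qed
    ultimately show ?thesis by blast
  qed
qed

lemma Phi_bij: "bij_betw Phi (Vsp B) W"
  unfolding bij_betw_def
proof
  show "inj_on Phi (Vsp B)"
  proof (rule inj_onI)
    fix v w assume h: "v \<in> Vsp B" "w \<in> Vsp B" "Phi v = Phi w"
    have "(\<lambda>U. 1 * v U + (- 1) * w U) \<in> Vsp B" using h by (simp add: Vsp_def)
    moreover have "Phi (\<lambda>U. 1 * v U + (- 1) * w U) = (\<lambda>x Q. 0)" unfolding Phi_linear using h(3) by simp
    ultimately have "(\<lambda>U. 1 * v U + (- 1) * w U) = (\<lambda>U. 0)" by (rule Phi_kernel)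
    then show "v = w" by (simp add: fun_eq_iff)
  qed
  show "Phi ` Vsp B = W" using Phi_in_W Phi_surj by blast
qed

lemma rep_iso_Dtabs: "rep_iso n B R W"
  unfolding rep_iso_def using Phi_bij Phi_linear Phi_intertwines by (intro exI[of _ Phi]) blast

end

theorem theorem5p5:
  fixes S :: "cell set" and m :: nat
  assumes "skew_shape S" and "card S \<ge> 2" and "m \<ge> 1"
  shows "rep_iso (card S) (Dtabs S m True) (rhoop S m True) (IndV (card S) (SYT S) (gens1 S))
       \<and> rep_iso (card S) (Dtabs S m False) (rhoop S m False) (IndV (card S) (SYT S) (gens0 S))"
proof -
  interpret plus: D_tableaux S m True using assms by unfold_locales
  interpret minus: D_tableaux S m False using assms by unfold_locales
  have "{(sgen (gidx True i), youngop S i) | i. 1 \<le> i \<and> i < card S} = gens1 S"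
    by (simp add: gens1_def gidx_def)
  moreover have "{(sgen (gidx False i), youngop S i) | i. 1 \<le> i \<and> i < card S} = gens0 S"
  proof -
    \<comment> \<open>The index 1 is split off because it is the only one changed by
      \<open>gidx False\<close>, namely to 0.\<close>
    have "{i. 1 \<le> i \<and> i < card S} = insert 1 {i. 2 \<le> i \<and> i < card S}" using assms(2) by auto
    then have "(\<lambda>i. (sgen (gidx False i), youngop S i)) ` {i. 1 \<le> i \<and> i < card S}
      = insert (sgen 0, youngop S 1) ((\<lambda>i. (sgen (gidx False i), youngop S i)) ` {i. 2 \<le> i \<and> i < card S})"
      by (simp add: gidx_def)
    also have "(\<lambda>i. (sgen (gidx False i), youngop S i)) ` {i. 2 \<le> i \<and> i < card S}
      = (\<lambda>i. (sgen i, youngop S i)) ` {i. 2 \<le> i \<and> i < card S}"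
      by (rule image_cong) (auto simp: gidx_def)
    finally show ?thesis by (auto simp: gens0_def image_def)
  qed
  ultimately show ?thesis using plus.rep_iso_Dtabs minus.rep_iso_Dtabs by simp
qed

end
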